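(* Let $N\ge2$, $d>0$, and consider the one-dimensional extended homogeneous Gaussian mixture model with parameters $(\theta,\mu)=(\theta_1,\dots,\theta_{N-1},\mu_1,\dots,\mu_N)$, at a fixed point with $1>\theta_1>\cdots>\theta_{N-1}>0$ and $\mu_{i+1}-\mu_i=d$ for $1\le i\le N-1$, all components having variance $\sigma^2$. Write its Wasserstein information matrix in block form $$G^{(ext)}_W(\theta,\mu;\sigma)=\begin{pmatrix}G_{\theta\theta}&G_{\theta\mu}\\ G_{\mu\theta}&G_{\mu\mu}\end{pmatrix},$$ with $G_{\theta\theta}\in\mathbb{R}^{(N-1)\times(N-1)}$, $G_{\theta\mu}=G_{\mu\theta}^T\in\mathbb{R}^{(N-1)\times N}$, $G_{\mu\mu}\in\mathbb{R}^{N\times N}$, and let $K(\sigma)=\sqrt{2\pi^3}\,\frac{\sigma^3}{d}e^{\frac{d^2}{8\sigma^2}}$. Then, as $\sigma\to0$, $$\frac{1}{K(\sigma)}\,G_{\theta\theta}\to\mathrm{diag}\left(\frac1{\sqrt{p_1p_2}},\frac{1}{\sqrt{p_2p_3}},\dots,\frac1{\sqrt{p_{N-1}p_N}}\right),\qquad G_{\mu\mu}\to\mathrm{diag}(p_1,p_2,\dots,p_N),$$ and $G_{\theta\mu}$ converges to the $(N-1)\times N$ matrix whose $(i,i)$ and $(i,i+1)$ entries both equal $\frac{\mu_{i+1}-\mu_i}{2}$ for $1\le i\le N-1$, all other entries being $0$.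
   Context: Extended 1D Gaussian mixture model: with $\rho_i(x)=\frac{1}{\sqrt{2\pi}\sigma}e^{-(x-\mu_i)^2/(2\sigma^2)}$ and $1=\theta_0>\theta_1>\cdots>\theta_{N-1}>\theta_N=0$, $\mu_1<\cdots<\mu_N$, set $$\rho_{\theta,\mu}=\sum_{i=1}^{N-1}\theta_i(\rho_{i+1}-\rho_i)+\rho_1=\sum_{i=1}^Np_i\rho_i,\qquad p_i=\theta_{i-1}-\theta_i>0.$$ Both the mixing parameters $\theta_i$ and the means $\mu_i$ are parameters of the model, while $\sigma$ is fixed. A basis of the tangent space is $\{\partial_{\theta_j}\}_{j=1}^{N-1}\cup\{\partial_{\mu_i}\}_{i=1}^N$. Wasserstein information matrix: the matrix of the pullback of the Wasserstein metric on densities on $\mathbb{R}$ to the parameter space; for parameters $\xi_a,\xi_b$ chosen from $\{\theta_j\}\cup\{\mu_i\}$, its entry is $$\int_{\mathbb{R}}\frac{\partial_{\xi_a}F_{\theta,\mu}(x)\,\partial_{\xi_b}F_{\theta,\mu}(x)}{\rho_{\theta,\mu}(x)}\,dx,\qquad F_{\theta,\mu}(x)=\int_{-\infty}^x\rho_{\theta,\mu}(s)\,ds .$$ *)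

theory Defs
  imports "HOL-Probability.Probability" "Jordan_Normal_Form.Matrix"
begin

text \<open>
  A parameter point is given by \<open>\<theta> \<mu> :: nat \<Rightarrow> real\<close>, indexed from 1; the values
  \<open>\<theta> 0 = 1\<close> and \<open>\<theta> N = 0\<close> are the boundary conventions, not parameters.
\<close>

definition gmm_density :: "nat \<Rightarrow> (nat \<Rightarrow> real) \<Rightarrow> (nat \<Rightarrow> real) \<Rightarrow> real \<Rightarrow> real \<Rightarrow> real" where
  "gmm_density N \<theta> \<mu> \<sigma> x =
     (\<Sum>i = 1..N - 1. \<theta> i * (normal_density (\<mu> (i + 1)) \<sigma> x - normal_density (\<mu> i) \<sigma> x))
     + normal_density (\<mu> 1) \<sigma> x"

definition gmm_weight :: "(nat \<Rightarrow> real) \<Rightarrow> nat \<Rightarrow> real" where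
  "gmm_weight \<theta> i = \<theta> (i - 1) - \<theta> i"

lemma gmm_density_eq_mixture:
  assumes "N \<ge> 1" "\<theta> 0 = 1" "\<theta> N = 0"
  shows "gmm_density N \<theta> \<mu> \<sigma> x = (\<Sum>i = 1..N. gmm_weight \<theta> i * normal_density (\<mu> i) \<sigma> x)"
proof -
  have "(\<Sum>i = 1..Suc n. gmm_weight \<theta> i * normal_density (\<mu> i) \<sigma> x) =
      gmm_density (Suc n) \<theta> \<mu> \<sigma> x - \<theta> (Suc n) * normal_density (\<mu> (Suc n)) \<sigma> x" for n
    by (induction n) (auto simp: gmm_density_def gmm_weight_def assms(2) algebra_simps)
  from this[of "N - 1"] show ?thesis
    using assms by simp
qed

definition gmm_cdf :: "nat \<Rightarrow> (nat \<Rightarrow> real) \<Rightarrow> (nat \<Rightarrow> real) \<Rightarrow> real \<Rightarrow> real \<Rightarrow> real" where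
  "gmm_cdf N \<theta> \<mu> \<sigma> x = (LINT s:{..x}|lborel. gmm_density N \<theta> \<mu> \<sigma> s)"

datatype gmm_param = Theta nat | Mu nat

definition gmm_params :: "nat \<Rightarrow> gmm_param list" where
  "gmm_params N = map Theta [1..<N] @ map Mu [1..<N + 1]"

fun gmm_cdf_partial ::
  "nat \<Rightarrow> (nat \<Rightarrow> real) \<Rightarrow> (nat \<Rightarrow> real) \<Rightarrow> real \<Rightarrow> gmm_param \<Rightarrow> real \<Rightarrow> real" where
  "gmm_cdf_partial N \<theta> \<mu> \<sigma> (Theta j) x = deriv (\<lambda>t. gmm_cdf N (\<theta>(j := t)) \<mu> \<sigma> x) (\<theta> j)"
| "gmm_cdf_partial N \<theta> \<mu> \<sigma> (Mu i) x = deriv (\<lambda>t. gmm_cdf N \<theta> (\<mu>(i := t)) \<sigma> x) (\<mu> i)"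

definition wim_integrand ::
  "nat \<Rightarrow> (nat \<Rightarrow> real) \<Rightarrow> (nat \<Rightarrow> real) \<Rightarrow> real \<Rightarrow> gmm_param \<Rightarrow> gmm_param \<Rightarrow> real \<Rightarrow> real" where
  "wim_integrand N \<theta> \<mu> \<sigma> a b x =
     gmm_cdf_partial N \<theta> \<mu> \<sigma> a x * gmm_cdf_partial N \<theta> \<mu> \<sigma> b x / gmm_density N \<theta> \<mu> \<sigma> x"

definition wasserstein_information_matrix ::
  "nat \<Rightarrow> (nat \<Rightarrow> real) \<Rightarrow> (nat \<Rightarrow> real) \<Rightarrow> real \<Rightarrow> real mat" where
  "wasserstein_information_matrix N \<theta> \<mu> \<sigma> =
     Matrix.mat (length (gmm_params N)) (length (gmm_params N))
       (\<lambda>(k, l). LINT x|lborel. wim_integrand N \<theta> \<mu> \<sigma> (gmm_params N ! k) (gmm_params N ! l) x)"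

definition wim_scale :: "real \<Rightarrow> real \<Rightarrow> real" where
  "wim_scale d \<sigma> = sqrt (2 * pi ^ 3) * (\<sigma> ^ 3 / d) * exp (d\<^sup>2 / (8 * \<sigma>\<^sup>2))"

text \<open>
  The type \<open>real mat\<close> carries no topology, so convergence to a matrix of fixed size
  is spelled out entrywise.
\<close>

definition mat_tendsto :: "('a \<Rightarrow> real mat) \<Rightarrow> real mat \<Rightarrow> 'a filter \<Rightarrow> bool" where
  "mat_tendsto A L F \<longleftrightarrow>
     eventually (\<lambda>s. A s \<in> carrier_mat (dim_row L) (dim_col L)) F \<and>
     (\<forall>i < dim_row L. \<forall>j < dim_col L. ((\<lambda>s. A s $$ (i, j)) \<longlongrightarrow> L $$ (i, j)) F)"

end

theory Submission
  imports Defs "HOL-Real_Asymp.Real_Asymp"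
begin

text \<open>
  Write \<open>\<Phi>\<^sub>i\<close> for the distribution function of component \<open>i\<close>, \<open>h\<^sub>i = \<Phi>\<^sub>i - \<Phi>\<^sub>i\<^sub>+\<^sub>1\<close> (called \<open>bump\<close>) and
  \<open>r\<^sub>j = p\<^sub>j \<rho>\<^sub>j / \<rho>\<close> (called \<open>resp\<close>). The integrands of the three blocks are \<open>h\<^sub>i h\<^sub>j / \<rho>\<close>, \<open>h\<^sub>i r\<^sub>j\<close> and \<open>p\<^sub>i \<rho>\<^sub>i r\<^sub>j\<close>.
  As \<open>\<sigma>\<close> tends to \<open>0\<close>, \<open>h\<^sub>i\<close> tends to the indicator of \<open>[\<mu>\<^sub>i, \<mu>\<^sub>i\<^sub>+\<^sub>1]\<close> and \<open>r\<^sub>j\<close> to the indicator of the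
  Voronoi cell of \<open>\<mu>\<^sub>j\<close>; dominated convergence gives the mixed block. In the \<open>\<mu>\<mu>\<close> block the off-diagonal
  entries are exponentially small, while the sum of row \<open>i\<close> is exactly \<open>p\<^sub>i\<close>. In the \<open>\<theta>\<theta>\<close> block everything
  away from the interior of \<open>[\<mu>\<^sub>i, \<mu>\<^sub>i\<^sub>+\<^sub>1]\<close> is \<open>O(\<sigma>)\<close>, because a Gaussian tail of \<open>h\<^sub>i\<close> is dominated by the
  adjacent component of \<open>\<rho>\<close>. The diagonal blow-up comes from the valley of \<open>\<rho>\<close> at the midpoint of
  \<open>\<mu>\<^sub>i\<close> and \<open>\<mu>\<^sub>i\<^sub>+\<^sub>1\<close>: at distance \<open>\<sigma>\<^sup>2 t / d\<close> from it, \<open>\<rho>\<close> is proportional to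
  \<open>p\<^sub>i exp (- t / 2) + p\<^sub>i\<^sub>+\<^sub>1 exp (t / 2)\<close>, whose reciprocal has integral \<open>\<pi> / sqrt (p\<^sub>i p\<^sub>i\<^sub>+\<^sub>1)\<close>.
\<close>

section \<open>Gaussian distribution functions\<close>

definition gauss_cdf :: "real \<Rightarrow> real \<Rightarrow> real \<Rightarrow> real" where
  "gauss_cdf m \<sigma> x = (LINT s:{..x}|lborel. normal_density m \<sigma> s)"

lemma set_integrable_normal_density:
  assumes "\<sigma> > 0" "S \<in> sets borel"
  shows "set_integrable lborel S (normal_density m \<sigma>)"
  unfolding set_integrable_def
  using integrable_mult_indicator[of S lborel "normal_density m \<sigma>"] assms by auto

text \<open>Translation moves the mean into the argument, which later turns the derivative in the
  mean into the derivative in \<open>x\<close>.\<close>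

lemma gauss_cdf_shift: "gauss_cdf m \<sigma> x = gauss_cdf 0 \<sigma> (x - m)"
proof -
  have "gauss_cdf m \<sigma> x = (LINT s|lborel. indicator {..x} (m + 1 * s) *\<^sub>R normal_density m \<sigma> (m + 1 * s))"
    unfolding gauss_cdf_def set_lebesgue_integral_def
    by (subst lborel_integral_real_affine[of 1 _ m]) simp_all
  also have "\<dots> = gauss_cdf 0 \<sigma> (x - m)"
    unfolding gauss_cdf_def set_lebesgue_integral_def
    by (rule Bochner_Integration.integral_cong) (auto simp: normal_density_def indicator_def)
  finally show ?thesis .
qed

lemma gauss_cdf_nonneg: "gauss_cdf m \<sigma> x \<ge> 0"
  unfolding gauss_cdf_def set_lebesgue_integral_def
  by (rule Bochner_Integration.integral_nonneg) (auto simp: indicator_def)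

text \<open>Writing the upper tail as an integral over a half-line lets one estimate serve both
  tails.\<close>

lemma gauss_cdf_complement:
  assumes "\<sigma> > 0"
  shows "1 - gauss_cdf m \<sigma> x = (LINT s:{x<..}|lborel. normal_density m \<sigma> s)"
proof -
  have "(LINT s:{..x} \<union> {x<..}|lborel. normal_density m \<sigma> s)
      = gauss_cdf m \<sigma> x + (LINT s:{x<..}|lborel. normal_density m \<sigma> s)"
    unfolding gauss_cdf_def
    by (intro set_integral_Un set_integrable_normal_density assms) auto
  moreover have "{..x} \<union> {x<..} = UNIV"
    by auto
  moreover have "(LINT s:UNIV|lborel. normal_density m \<sigma> s) = 1"
    using integral_normal_density[OF assms] by (simp add: set_lebesgue_integral_def)
  ultimately show ?thesis by simp
qed

lemma gauss_cdf_le_1: "\<sigma> > 0 \<Longrightarrow> gauss_cdf m \<sigma> x \<le> 1"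
proof -
  assume "\<sigma> > 0"
  have "(LINT s:{x<..}|lborel. normal_density m \<sigma> s) \<ge> 0"
    unfolding set_lebesgue_integral_def
    by (rule Bochner_Integration.integral_nonneg) (auto simp: indicator_def)
  with gauss_cdf_complement[OF \<open>\<sigma> > 0\<close>, of m x] show ?thesis by simp
qed

lemma normal_density_eq_exp:
  "normal_density m \<sigma> x = exp (- (x - m)\<^sup>2 / (2 * \<sigma>\<^sup>2)) / sqrt (2 * pi * \<sigma>\<^sup>2)"
  by (simp add: normal_density_def)

text \<open>For \<open>x\<close> between \<open>s\<close> and \<open>m\<close> one has \<open>(s - m)\<^sup>2 \<ge> (s - x)\<^sup>2 + (x - m)\<^sup>2\<close>.\<close>

lemma normal_density_tail_le:
  assumes "\<sigma> > 0" "(s - x) * (x - m) \<ge> 0"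
  shows "normal_density m \<sigma> s \<le> exp (- (x - m)\<^sup>2 / (2 * \<sigma>\<^sup>2)) * normal_density x \<sigma> s"
proof -
  have "(s - m)\<^sup>2 \<ge> (x - m)\<^sup>2 + (s - x)\<^sup>2"
    using assms(2) by (simp add: power2_eq_square algebra_simps)
  then have "- (s - m)\<^sup>2 / (2 * \<sigma>\<^sup>2) \<le> - (x - m)\<^sup>2 / (2 * \<sigma>\<^sup>2) + - (s - x)\<^sup>2 / (2 * \<sigma>\<^sup>2)"
    unfolding add_divide_distrib[symmetric] by (intro divide_right_mono) auto
  then show ?thesis
    unfolding normal_density_eq_exp times_divide_eq_right exp_add[symmetric]
    by (intro divide_right_mono) auto
qed

text \<open>The comparison density centred at \<open>x\<close> has total mass 1, so integrating it
  over the whole line leaves only the exponential. The sign condition describes points beyond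
  \<open>x\<close> as seen from \<open>m\<close>, on either side.\<close>

lemma set_integral_normal_density_tail_le:
  assumes "\<sigma> > 0" "S \<in> sets borel" "\<And>s. s \<in> S \<Longrightarrow> (s - x) * (x - m) \<ge> 0"
  shows "(LINT s:S|lborel. normal_density m \<sigma> s) \<le> exp (- (x - m)\<^sup>2 / (2 * \<sigma>\<^sup>2))"
proof -
  let ?E = "exp (- (x - m)\<^sup>2 / (2 * \<sigma>\<^sup>2))"
  have "(LINT s:S|lborel. normal_density m \<sigma> s) \<le> (LINT s|lborel. ?E * normal_density x \<sigma> s)"
    unfolding set_lebesgue_integral_def
    using set_integrable_normal_density[OF assms(1,2), of m] normal_density_tail_le[OF assms(1,3)]
      integrable_normal_density[OF assms(1), of x]
    by (intro integral_mono) (auto simp: set_integrable_def indicator_def)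
  also have "\<dots> = ?E"
    using integral_normal_density[OF assms(1), of x] by simp
  finally show ?thesis .
qed

lemma gauss_cdf_lower_tail:
  assumes "\<sigma> > 0" "x \<le> m"
  shows "gauss_cdf m \<sigma> x \<le> exp (- (x - m)\<^sup>2 / (2 * \<sigma>\<^sup>2))"
  unfolding gauss_cdf_def
  by (rule set_integral_normal_density_tail_le) (use assms in \<open>auto intro: mult_nonpos_nonpos\<close>)

lemma gauss_cdf_upper_tail:
  assumes "\<sigma> > 0" "m \<le> x"
  shows "1 - gauss_cdf m \<sigma> x \<le> exp (- (x - m)\<^sup>2 / (2 * \<sigma>\<^sup>2))"
  unfolding gauss_cdf_complement[OF assms(1)]
  by (rule set_integral_normal_density_tail_le) (use assms in auto)

lemma gauss_cdf_has_derivative: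
  assumes "\<sigma> > 0"
  shows "(gauss_cdf m \<sigma> has_real_derivative normal_density m \<sigma> x) (at x)"
proof -
  let ?f = "normal_density m \<sigma>"
  \<comment> \<open>The fundamental theorem of calculus is applied on a compact interval around
    \<open>x\<close>; the mass to the left of \<open>a\<close> is a constant that differentiation
    removes.\<close>
  define a b where "a = x - 1" and "b = x + 1"
  have cont: "continuous_on S ?f" for S
    unfolding normal_density_def by (intro continuous_intros) (use assms in auto)
  have eq: "gauss_cdf m \<sigma> u = gauss_cdf m \<sigma> a + integral {a..u} ?f" if "u \<in> {a..b}" for u
  proof -
    have "gauss_cdf m \<sigma> u = (LINT s:{..<a} \<union> {a..u}|lborel. ?f s)"
      unfolding gauss_cdf_def using that by (intro arg_cong[where f = "\<lambda>S. set_lebesgue_integral lborel S ?f"]) auto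
    also have "\<dots> = (LINT s:{..<a}|lborel. ?f s) + (LINT s:{a..u}|lborel. ?f s)"
      by (intro set_integral_Un set_integrable_normal_density assms) auto
    also have "(LINT s:{..<a}|lborel. ?f s) = gauss_cdf m \<sigma> a"
      unfolding gauss_cdf_def set_lebesgue_integral_def
      by (intro integral_cong_AE) (use AE_lborel_singleton[of a] in \<open>auto simp: indicator_def\<close>)
    also have "(LINT s:{a..u}|lborel. ?f s) = integral {a..u} ?f"
      by (intro set_borel_integral_eq_integral set_integrable_normal_density assms) auto
    finally show ?thesis .
  qed
  have "((\<lambda>u. gauss_cdf m \<sigma> a + integral {a..u} ?f) has_real_derivative ?f x) (at x within {a..b})"
    by (rule derivative_eq_intros integral_has_real_derivative cont refl)+ (auto simp: a_def b_def)
  then have "((\<lambda>u. gauss_cdf m \<sigma> a + integral {a..u} ?f) has_real_derivative ?f x) (at x within {a<..<b})"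
    by (rule DERIV_subset) auto
  then have "((\<lambda>u. gauss_cdf m \<sigma> a + integral {a..u} ?f) has_real_derivative ?f x) (at x)"
    by (subst (asm) at_within_open) (auto simp: a_def b_def)
  then show ?thesis
    by (rule has_field_derivative_transform_within_open[of _ _ _ "{a<..<b}"])
      (simp, simp add: a_def b_def, rule eq[symmetric], simp)
qed

lemma gauss_cdf_has_derivative_mean:
  assumes "\<sigma> > 0"
  shows "((\<lambda>m. gauss_cdf m \<sigma> x) has_real_derivative - normal_density m \<sigma> x) (at m)"
proof -
  have "((\<lambda>m. gauss_cdf 0 \<sigma> (x - m)) has_real_derivative normal_density 0 \<sigma> (x - m) * (- 1)) (at m)"
    by (rule DERIV_chain2[OF gauss_cdf_has_derivative[OF assms]]) (auto intro!: derivative_eq_intros)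
  then show ?thesis
    by (subst gauss_cdf_shift[abs_def]) (simp add: normal_density_def)
qed

lemma borel_measurable_gauss_cdf:
  assumes "\<sigma> > 0"
  shows "gauss_cdf m \<sigma> \<in> borel_measurable borel"
  by (intro borel_measurable_continuous_onI continuous_at_imp_continuous_on ballI
      DERIV_isCont[OF gauss_cdf_has_derivative[OF assms]])

lemma gauss_cdf_antimono_mean:
  assumes "\<sigma> > 0" "m \<le> m'"
  shows "gauss_cdf m' \<sigma> x \<le> gauss_cdf m \<sigma> x"
  using assms(2) by (rule DERIV_nonpos_imp_nonincreasing[where f = "\<lambda>m. gauss_cdf m \<sigma> x"])
    (use gauss_cdf_has_derivative_mean[OF assms(1)] normal_density_nonneg in fastforce)

section \<open>Integrals and limits\<close>

text \<open>The substitution \<open>y = sqrt (q / p) * exp (a * t)\<close> turns the integral into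
  that of \<open>1 / (a * sqrt (p * q) * (1 + y^2))\<close> over \<open>y > 0\<close>, whence the
  arctan. The case \<open>a = 1/2\<close> gives the limit constant of the
  \<open>\<theta>\<theta>\<close> block, \<open>a = 1/4\<close> an integrable majorant.\<close>

lemma
  fixes a p q :: real
  assumes a: "a > 0" and p: "p > 0" and q: "q > 0"
  shows integrable_inverse_exp_sum: "integrable lborel (\<lambda>t. 1 / (p * exp (- (a * t)) + q * exp (a * t)))"
    and integral_inverse_exp_sum:
      "(LINT t|lborel. 1 / (p * exp (- (a * t)) + q * exp (a * t))) = pi / (2 * a * sqrt (p * q))"
proof -
  let ?f = "\<lambda>t. 1 / (p * exp (- (a * t)) + q * exp (a * t))"
  let ?F = "\<lambda>t. arctan (sqrt (q / p) * exp (a * t)) / (a * sqrt (p * q))"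
  have pos: "p * exp (- (a * t)) + q * exp (a * t) > 0" for t
    using p q by (simp add: add_pos_pos)
  have deriv: "(?F has_real_derivative ?f t) (at t)" for t
  proof -
    have quotient: "sqrt (q / p) / sqrt (p * q) = 1 / p"
      using p q by (simp add: real_sqrt_divide real_sqrt_mult)
    have denominator: "1 + (sqrt (q / p) * exp (a * t))\<^sup>2 = 1 + q / p * (exp (a * t))\<^sup>2"
      using p q by (simp add: power_mult_distrib)
    have "(?F has_real_derivative
        inverse (1 + (sqrt (q / p) * exp (a * t))\<^sup>2) * (sqrt (q / p) * (exp (a * t) * a)) / (a * sqrt (p * q))) (at t)"
      by (intro DERIV_cdivide DERIV_chain2[where f = arctan] DERIV_arctan) (auto intro!: derivative_eq_intros)
    also have "inverse (1 + (sqrt (q / p) * exp (a * t))\<^sup>2) * (sqrt (q / p) * (exp (a * t) * a)) / (a * sqrt (p * q))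
        = (sqrt (q / p) / sqrt (p * q)) * (exp (a * t) / (1 + q / p * (exp (a * t))\<^sup>2))"
      unfolding denominator using a by (simp add: divide_inverse mult_ac)
    also have "\<dots> = exp (a * t) / (p + q * (exp (a * t))\<^sup>2)"
      unfolding quotient using p by (simp add: field_simps)
    also have "\<dots> = ?f t"
      using pos[of t] by (simp add: exp_minus power2_eq_square field_simps)
    finally show ?thesis .
  qed
  have cont: "isCont ?f t" for t
    using pos[of t] by (intro continuous_intros) auto
  have bot: "(?F \<longlongrightarrow> 0) at_bot" and top: "(?F \<longlongrightarrow> pi / 2 / (a * sqrt (p * q))) at_top"
  proof -
    have e: "((\<lambda>t. exp (a * t)) \<longlongrightarrow> 0) at_bot" "filterlim (\<lambda>t. exp (a * t)) at_top at_top"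
      using a by real_asymp+
    show "(?F \<longlongrightarrow> 0) at_bot"
      by (rule tendsto_eq_intros refl e(1))+ (use a p q in auto)
    have "filterlim (\<lambda>t. sqrt (q / p) * exp (a * t)) at_top at_top"
      using p q by (intro filterlim_tendsto_pos_mult_at_top[OF tendsto_const _ e(2)]) auto
    then have "((\<lambda>t. arctan (sqrt (q / p) * exp (a * t))) \<longlongrightarrow> pi / 2) at_top"
      by (rule filterlim_compose[OF tendsto_arctan_at_top])
    then show "(?F \<longlongrightarrow> pi / 2 / (a * sqrt (p * q))) at_top"
      by (intro tendsto_intros) (use a p q in auto)
  qed
  \<comment> \<open>For a nonnegative integrand, the limits of the antiderivative at both infinities
    yield integrability as well as the value.\<close>
  note FTC = interval_integral_FTC_nonneg[of "-\<infinity>" "\<infinity>" ?F ?f 0 "pi / 2 / (a * sqrt (p * q))"]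
  have "(((\<lambda>x. ?F x) \<circ> real_of_ereal) \<longlongrightarrow> 0) (at_right (-\<infinity>))"
    "(((\<lambda>x. ?F x) \<circ> real_of_ereal) \<longlongrightarrow> pi / 2 / (a * sqrt (p * q))) (at_left \<infinity>)"
    unfolding ereal_tendsto_simps1 by (rule bot top)+
  note FTC' = FTC[OF _ deriv cont _ this]
  have nonneg: "AE t in lborel. -\<infinity> < ereal t \<longrightarrow> ereal t < \<infinity> \<longrightarrow> 0 \<le> ?f t"
    by (intro AE_I2) (use pos in \<open>simp add: less_imp_le\<close>)
  have "set_integrable lborel (einterval (-\<infinity>) \<infinity>) ?f"
    by (rule FTC'(1)[OF _ nonneg]) simp
  then show "integrable lborel ?f"
    by (simp add: set_integrable_def)
  have "(LBINT t=-\<infinity>..\<infinity>. ?f t) = pi / 2 / (a * sqrt (p * q)) - 0"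
    by (rule FTC'(2)[OF _ nonneg]) simp
  moreover have "(LBINT t=-\<infinity>..\<infinity>. ?f t) = (LINT t|lborel. ?f t)"
    by (simp add: interval_lebesgue_integral_def set_lebesgue_integral_def)
  ultimately show "(LINT t|lborel. ?f t) = pi / (2 * a * sqrt (p * q))"
    by simp
qed

text \<open>The substitution \<open>\<sigma> = 1 / t\<close> transfers dominated convergence from
  \<open>at_top\<close>.\<close>

lemma integral_dominated_convergence_at_right_0:
  fixes s :: "real \<Rightarrow> 'a \<Rightarrow> 'b::{banach, second_countable_topology}"
  assumes "f \<in> borel_measurable M" "\<And>\<sigma>. \<sigma> > 0 \<Longrightarrow> s \<sigma> \<in> borel_measurable M" "integrable M w"
    and lim: "AE x in M. ((\<lambda>\<sigma>. s \<sigma> x) \<longlongrightarrow> f x) (at_right 0)"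
    and bound: "\<forall>\<^sub>F \<sigma> in at_right 0. AE x in M. norm (s \<sigma> x) \<le> w x"
  shows "((\<lambda>\<sigma>. integral\<^sup>L M (s \<sigma>)) \<longlongrightarrow> integral\<^sup>L M f) (at_right 0)"
proof -
  \<comment> \<open>Measurability is assumed only for positive \<open>\<sigma>\<close>, but
    dominated convergence at \<open>at_top\<close> asks for it at every \<open>t\<close>; the zero
    function fills in for \<open>t \<le> 0\<close>.\<close>
  define s' where "s' t = (if t > 0 then s (inverse t) else (\<lambda>_. 0))" for t :: real
  have s': "\<forall>\<^sub>F t in at_top. s' t = s (inverse t)"
    using eventually_gt_at_top[of 0] by eventually_elim (simp add: s'_def)
  have "((\<lambda>t. integral\<^sup>L M (s' t)) \<longlongrightarrow> integral\<^sup>L M f) at_top"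
  proof (rule integral_dominated_convergence_at_top[where w = w])
    show "s' t \<in> borel_measurable M" for t
      using assms(2) by (auto simp: s'_def)
    show "AE x in M. ((\<lambda>t. s' t x) \<longlongrightarrow> f x) at_top"
      using lim
    proof eventually_elim
      case (elim x)
      then have "((\<lambda>t. s (inverse t) x) \<longlongrightarrow> f x) at_top"
        by (simp add: filterlim_at_right_to_top)
      then show ?case
        by (rule Lim_transform_eventually) (use s' in \<open>eventually_elim, simp\<close>)
    qed
    have "\<forall>\<^sub>F t in at_top. AE x in M. norm (s (inverse t) x) \<le> w x"
      using bound by (simp add: at_right_to_top eventually_filtermap)
    then show "\<forall>\<^sub>F t in at_top. AE x in M. norm (s' t x) \<le> w x"
      using s' by eventually_elim simp
  qed (use assms in auto)
  then have "((\<lambda>t. integral\<^sup>L M (s (inverse t))) \<longlongrightarrow> integral\<^sup>L M f) at_top"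
    by (rule Lim_transform_eventually) (use s' in \<open>eventually_elim, simp\<close>)
  then show ?thesis
    by (simp add: filterlim_at_right_to_top)
qed

lemma exp_neg_div_square_tendsto_0:
  fixes c :: real
  assumes "c > 0"
  shows "((\<lambda>\<sigma>. exp (- c / (2 * \<sigma>\<^sup>2))) \<longlongrightarrow> 0) (at_right 0)"
  using assms by real_asymp

lemma tendsto_sandwich_at_right:
  fixes f g h :: "real \<Rightarrow> real"
  assumes "\<And>x. x > a \<Longrightarrow> f x \<le> g x" "\<And>x. x > a \<Longrightarrow> g x \<le> h x"
    and "(f \<longlongrightarrow> c) (at_right a)" "(h \<longlongrightarrow> c) (at_right a)"
  shows "(g \<longlongrightarrow> c) (at_right a)"
  by (rule tendsto_sandwich[OF _ _ assms(3,4)])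
    (rule eventually_mono[OF eventually_at_right_less[of a]], erule assms)+

lemma integrable_gaussian:
  assumes "\<sigma> > 0"
  shows "integrable lborel (\<lambda>x::real. exp (- (x - m)\<^sup>2 / (2 * \<sigma>\<^sup>2)))"
proof -
  have "integrable lborel (\<lambda>x. sqrt (2 * pi * \<sigma>\<^sup>2) * normal_density m \<sigma> x)"
    using assms by (intro integrable_mult_right) auto
  then show ?thesis
    using assms by (simp add: normal_density_eq_exp)
qed

lemma integrable_indicator_Icc: "integrable lborel (indicator {a..b::real} :: real \<Rightarrow> real)"
  by (rule integrable_real_indicator) (simp_all add: emeasure_lborel_Icc_eq)

text \<open>Completing the square: the geometric mean of two Gaussians of equal variance is a damped
  Gaussian at the midpoint of the means. The damping makes the off-diagonal
  \<open>\<mu>\<mu>\<close> entries exponentially small.\<close>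

lemma normal_density_product_eq:
  fixes m m' :: real
  assumes "\<sigma> > 0"
  shows "normal_density m \<sigma> x * normal_density m' \<sigma> x
    = (exp (- (m - m')\<^sup>2 / (8 * \<sigma>\<^sup>2)) * normal_density ((m + m') / 2) \<sigma> x)\<^sup>2"
proof -
  have "- (x - m)\<^sup>2 / (2 * \<sigma>\<^sup>2) + - (x - m')\<^sup>2 / (2 * \<sigma>\<^sup>2)
      = 2 * (- (m - m')\<^sup>2 / (8 * \<sigma>\<^sup>2) + - (x - (m + m') / 2)\<^sup>2 / (2 * \<sigma>\<^sup>2))"
    using assms by (simp add: field_simps power2_eq_square)
  then have "exp (- (x - m)\<^sup>2 / (2 * \<sigma>\<^sup>2)) * exp (- (x - m')\<^sup>2 / (2 * \<sigma>\<^sup>2))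
      = (exp (- (m - m')\<^sup>2 / (8 * \<sigma>\<^sup>2)) * exp (- (x - (m + m') / 2)\<^sup>2 / (2 * \<sigma>\<^sup>2)))\<^sup>2"
    unfolding exp_add[symmetric] exp_double[symmetric] by (rule arg_cong)
  then show ?thesis
    unfolding normal_density_eq_exp by (simp add: power2_eq_square)
qed

lemma eventually_at_right_0_1: "\<forall>\<^sub>F \<sigma>::real in at_right 0. 0 < \<sigma> \<and> \<sigma> < 1"
  using eventually_at_right_real[of 0 "1::real"] by simp

text \<open>The factors have separate origins: \<open>pi\<close> comes from the arctan integral,
  \<open>sqrt (2 * pi) * \<sigma> * exp (...)\<close> is the reciprocal height of a component at
  distance \<open>d / 2\<close> from its mean, and \<open>\<sigma>^2 / d\<close> is the Jacobian of
  the rescaling at the midpoint.\<close>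

lemma wim_scale_eq:
  "wim_scale d \<sigma> = pi * (sqrt (2 * pi) * \<sigma> * exp (d\<^sup>2 / (8 * \<sigma>\<^sup>2)) * (\<sigma>\<^sup>2 / d))"
  by (simp add: wim_scale_def power3_eq_cube power2_eq_square real_sqrt_mult mult_ac)

text \<open>The exponential in \<open>wim_scale\<close> beats every power of
  \<open>\<sigma>\<close>, so contributions of order \<open>\<sigma>\<close> to a
  \<open>\<theta>\<theta>\<close> entry vanish after scaling.\<close>

lemma sigma_div_wim_scale_tendsto:
  assumes "d > 0"
  shows "((\<lambda>\<sigma>. \<sigma> / wim_scale d \<sigma>) \<longlongrightarrow> 0) (at_right 0)"
proof -
  have "((\<lambda>\<sigma>::real. d / (pi * sqrt (2 * pi)) * (exp (- (d\<^sup>2 / (8 * \<sigma>\<^sup>2))) / \<sigma>\<^sup>2)) \<longlongrightarrow> 0) (at_right 0)"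
    using assms by real_asymp
  moreover have "\<forall>\<^sub>F \<sigma> in at_right 0. d / (pi * sqrt (2 * pi)) * (exp (- (d\<^sup>2 / (8 * \<sigma>\<^sup>2))) / \<sigma>\<^sup>2) = \<sigma> / wim_scale d \<sigma>"
    using eventually_at_right_less[of 0]
    by eventually_elim (use assms in \<open>simp add: wim_scale_eq exp_minus field_simps\<close>)
  ultimately show ?thesis
    by (rule Lim_transform_eventually)
qed

text \<open>With \<open>y = exp (\<bar>t\<bar> / 4) \<ge> 1\<close> this is \<open>y * (y + 1 / y) \<le> 2 * (y\<^sup>2 + 1 / y\<^sup>2)\<close>.\<close>

lemma exp_quarter_div_le:
  fixes t :: real
  shows "exp (\<bar>t\<bar> / 4) / (exp (- (t / 2)) + exp (t / 2)) \<le> 2 * (1 / (1 * exp (- (1 / 4 * t)) + 1 * exp (1 / 4 * t)))"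
proof -
  define y where "y = exp (\<bar>t\<bar> / 4)"
  have y: "y \<ge> 1"
    by (simp add: y_def)
  have "exp (- (t / 2)) + exp (t / 2) = exp (\<bar>t\<bar> / 2) + exp (- (\<bar>t\<bar> / 2))"
    by (cases "t \<ge> 0") simp_all
  moreover have "exp (\<bar>t\<bar> / 2) = y\<^sup>2"
    by (simp add: y_def flip: exp_double)
  ultimately have half: "exp (- (t / 2)) + exp (t / 2) = y\<^sup>2 + 1 / y\<^sup>2"
    by (simp add: exp_minus inverse_eq_divide)
  have quarter: "1 * exp (- (1 / 4 * t)) + 1 * exp (1 / 4 * t) = y + 1 / y"
    by (cases "t \<ge> 0") (simp_all add: y_def exp_minus field_simps)
  have "y * (y + 1 / y) = y\<^sup>2 + 1"
    using y by (simp add: algebra_simps power2_eq_square)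
  also have "\<dots> \<le> 2 * y\<^sup>2"
    using one_le_power[OF y, of 2] by simp
  also have "\<dots> \<le> 2 * (y\<^sup>2 + 1 / y\<^sup>2)"
    by simp
  finally have "y * (y + 1 / y) \<le> 2 * (y\<^sup>2 + 1 / y\<^sup>2)" .
  moreover have "y + 1 / y > 0" "y\<^sup>2 + 1 / y\<^sup>2 > 0"
    using y by (simp_all add: add_pos_pos)
  ultimately have "y / (y\<^sup>2 + 1 / y\<^sup>2) \<le> 2 * (1 / (y + 1 / y))"
    by (simp add: pos_divide_le_eq pos_le_divide_eq)
  then show ?thesis
    unfolding half quarter by (simp add: y_def)
qed

section \<open>Gaussian mixtures with equally spaced means\<close>

text \<open>The integrands of all blocks involve \<open>\<theta>\<close> only through the weights,
  so the analysis uses \<open>p\<close> in place of \<open>\<theta>\<close>.\<close>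

locale gaussian_mixture =
  fixes N :: nat and p \<mu> :: "nat \<Rightarrow> real" and d :: real
  assumes weight_pos: "k \<in> {1..N} \<Longrightarrow> p k > 0"
    and d_pos: "d > 0"
    and spacing: "i \<in> {1..<N} \<Longrightarrow> \<mu> (i + 1) - \<mu> i = d"
begin

definition dens :: "real \<Rightarrow> real \<Rightarrow> real" where
  "dens \<sigma> x = (\<Sum>k = 1..N. p k * normal_density (\<mu> k) \<sigma> x)"

text \<open>Minus the derivative of the mixture distribution function in \<open>\<theta> i\<close>;
  this sign makes it nonnegative.\<close>

definition bump :: "nat \<Rightarrow> real \<Rightarrow> real \<Rightarrow> real" where
  "bump i \<sigma> x = gauss_cdf (\<mu> i) \<sigma> x - gauss_cdf (\<mu> (i + 1)) \<sigma> x"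

text \<open>The responsibility, that is, the posterior probability of component \<open>k\<close>
  given the observation \<open>x\<close>.\<close>

definition resp :: "nat \<Rightarrow> real \<Rightarrow> real \<Rightarrow> real" where
  "resp k \<sigma> x = p k * normal_density (\<mu> k) \<sigma> x / dens \<sigma> x"

text \<open>A majorant of \<open>bump\<close> that increases with \<open>\<sigma>\<close>; its value
  at \<open>\<sigma> = 1\<close> is therefore an integrable bound for all smaller
  \<open>\<sigma>\<close> at once.\<close>

definition envelope :: "nat \<Rightarrow> real \<Rightarrow> real \<Rightarrow> real" where
  "envelope i \<sigma> x = indicator {\<mu> i..\<mu> (i + 1)} x
     + exp (- (x - \<mu> i)\<^sup>2 / (2 * \<sigma>\<^sup>2)) + exp (- (x - \<mu> (i + 1))\<^sup>2 / (2 * \<sigma>\<^sup>2))"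

lemma mean_eq: "k \<in> {1..N} \<Longrightarrow> \<mu> k = \<mu> 1 + (real k - 1) * d"
proof (induction k)
  case (Suc k)
  show ?case
  proof (cases "k = 0")
    case False
    then have "\<mu> k = \<mu> 1 + (real k - 1) * d" "\<mu> (k + 1) - \<mu> k = d"
      using Suc spacing[of k] by auto
    then show ?thesis by (simp add: algebra_simps)
  qed simp
qed simp

lemma mean_diff: "k \<in> {1..N} \<Longrightarrow> l \<in> {1..N} \<Longrightarrow> \<mu> k - \<mu> l = (real k - real l) * d"
  by (simp add: mean_eq[of k] mean_eq[of l] algebra_simps)

lemma mean_mono:
  assumes "k \<in> {1..N}" "l \<in> {1..N}" "k \<le> l"
  shows "\<mu> k \<le> \<mu> l"
proof -
  have "(real l - real k) * d \<ge> 0"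
    using assms(3) d_pos by simp
  then show ?thesis
    using mean_diff[OF assms(2,1)] by linarith
qed

lemma component_le_dens:
  assumes "k \<in> {1..N}"
  shows "p k * normal_density (\<mu> k) \<sigma> x \<le> dens \<sigma> x"
  unfolding dens_def
  by (rule member_le_sum[OF assms]) (auto intro!: mult_nonneg_nonneg less_imp_le[OF weight_pos])

lemma dens_pos:
  assumes "\<sigma> > 0" "k \<in> {1..N}"
  shows "dens \<sigma> x > 0"
  using component_le_dens[OF assms(2), of \<sigma> x] mult_pos_pos[OF weight_pos[OF assms(2)] normal_density_pos[OF assms(1), of "\<mu> k" x]]
  by linarith

lemma borel_measurable_dens [measurable]: "dens \<sigma> \<in> borel_measurable borel"
  unfolding dens_def[abs_def] by measurable

lemma borel_measurable_resp [measurable]: "resp k \<sigma> \<in> borel_measurable borel"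
  unfolding resp_def[abs_def] by measurable

lemma borel_measurable_bump: "\<sigma> > 0 \<Longrightarrow> bump i \<sigma> \<in> borel_measurable borel"
  unfolding bump_def[abs_def] by (intro borel_measurable_diff borel_measurable_gauss_cdf)

lemma resp_nonneg: "k \<in> {1..N} \<Longrightarrow> resp k \<sigma> x \<ge> 0"
  unfolding resp_def dens_def
  by (intro divide_nonneg_nonneg sum_nonneg mult_nonneg_nonneg)
    (auto intro: less_imp_le[OF weight_pos])

lemma resp_le_1: "\<sigma> > 0 \<Longrightarrow> k \<in> {1..N} \<Longrightarrow> resp k \<sigma> x \<le> 1"
  unfolding resp_def using component_le_dens[of k \<sigma> x] dens_pos[of \<sigma> k x] by simp

text \<open>This partition of unity recovers the dominant responsibility, and the diagonal
  \<open>\<mu>\<mu>\<close> entries, from the vanishing of the others.\<close>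

lemma sum_resp: "\<sigma> > 0 \<Longrightarrow> N \<ge> 1 \<Longrightarrow> (\<Sum>k = 1..N. resp k \<sigma> x) = 1"
  using dens_pos[of \<sigma> 1 x]
  by (simp add: resp_def dens_def flip: sum_divide_distrib)

text \<open>Since \<open>dens\<close> is at least its component \<open>k\<close>, a Gaussian factor
  centred at \<open>\<mu> k\<close> cancels against it up to the normalising constant, which is of
  order \<open>\<sigma>\<close>. The error estimates of the \<open>\<theta>\<theta>\<close> block
  rest on this.\<close>

lemma gaussian_div_dens_le:
  assumes "\<sigma> > 0" "k \<in> {1..N}"
  shows "exp (- (x - \<mu> k)\<^sup>2 / (2 * \<sigma>\<^sup>2)) / dens \<sigma> x \<le> sqrt (2 * pi) * \<sigma> / p k"
proof -
  have "sqrt (2 * pi * \<sigma>\<^sup>2) = sqrt (2 * pi) * \<sigma>"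
    using assms(1) by (simp add: real_sqrt_mult)
  then have "p k * exp (- (x - \<mu> k)\<^sup>2 / (2 * \<sigma>\<^sup>2)) / (sqrt (2 * pi) * \<sigma>) \<le> dens \<sigma> x"
    using component_le_dens[OF assms(2), of \<sigma> x] by (simp add: normal_density_eq_exp)
  moreover have "sqrt (2 * pi) * \<sigma> > 0"
    using assms(1) by simp
  ultimately have "p k * exp (- (x - \<mu> k)\<^sup>2 / (2 * \<sigma>\<^sup>2)) \<le> sqrt (2 * pi) * \<sigma> * dens \<sigma> x"
    by (metis mult.commute pos_divide_le_eq)
  then show ?thesis
    unfolding pos_divide_le_eq[OF dens_pos[OF assms]] times_divide_eq_left
      pos_le_divide_eq[OF weight_pos[OF assms(2)]]
    by (simp add: mult.commute)
qed

section \<open>Bounds for a single bump\<close>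

context
  fixes i :: nat and \<sigma> :: real
  assumes i: "i \<in> {1..<N}" and \<sigma>: "\<sigma> > 0"
begin

lemma bump_nonneg: "bump i \<sigma> x \<ge> 0"
  unfolding bump_def using gauss_cdf_antimono_mean[OF \<sigma>, of "\<mu> i" "\<mu> (i + 1)" x] mean_mono[of i "i + 1"] i by simp

lemma bump_le_1: "bump i \<sigma> x \<le> 1"
  unfolding bump_def using gauss_cdf_le_1[OF \<sigma>, of "\<mu> i" x] gauss_cdf_nonneg[of "\<mu> (i + 1)" \<sigma> x] by simp

lemma bump_le_lower_tail: "x \<le> \<mu> i \<Longrightarrow> bump i \<sigma> x \<le> exp (- (x - \<mu> i)\<^sup>2 / (2 * \<sigma>\<^sup>2))"
  unfolding bump_def using gauss_cdf_lower_tail[OF \<sigma>, of x "\<mu> i"] gauss_cdf_nonneg[of "\<mu> (i + 1)" \<sigma> x] by simp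

lemma bump_le_upper_tail: "\<mu> (i + 1) \<le> x \<Longrightarrow> bump i \<sigma> x \<le> exp (- (x - \<mu> (i + 1))\<^sup>2 / (2 * \<sigma>\<^sup>2))"
  unfolding bump_def using gauss_cdf_upper_tail[OF \<sigma>, of "\<mu> (i + 1)" x] gauss_cdf_le_1[OF \<sigma>, of "\<mu> i" x] by simp

lemma bump_ge:
  assumes "\<mu> i \<le> x" "x \<le> \<mu> (i + 1)"
  shows "bump i \<sigma> x \<ge> 1 - exp (- (x - \<mu> i)\<^sup>2 / (2 * \<sigma>\<^sup>2)) - exp (- (x - \<mu> (i + 1))\<^sup>2 / (2 * \<sigma>\<^sup>2))"
  unfolding bump_def
  using gauss_cdf_upper_tail[OF \<sigma> assms(1)] gauss_cdf_lower_tail[OF \<sigma> assms(2)] by simp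

lemma bump_le_envelope: "bump i \<sigma> x \<le> envelope i \<sigma> x"
proof -
  consider "x < \<mu> i" | "x \<in> {\<mu> i..\<mu> (i + 1)}" | "x > \<mu> (i + 1)"
    by fastforce
  then show ?thesis
  proof cases
    case 1
    then show ?thesis
      using bump_le_lower_tail[of x] by (simp add: envelope_def add_increasing2)
  next
    case 2
    then show ?thesis
      using bump_le_1[of x] by (simp add: envelope_def add_increasing2)
  next
    case 3
    then show ?thesis
      using bump_le_upper_tail[of x] by (simp add: envelope_def add_increasing)
  qed
qed

lemma envelope_mono:
  assumes "\<sigma> \<le> 1"
  shows "envelope i \<sigma> x \<le> envelope i 1 x"
proof -
  have "exp (- (x - m)\<^sup>2 / (2 * \<sigma>\<^sup>2)) \<le> exp (- (x - m)\<^sup>2 / (2 * 1\<^sup>2))" for m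
    unfolding exp_le_cancel_iff minus_divide_left[symmetric] neg_le_iff_le
    using \<sigma> assms power_mono[of \<sigma> 1 2] by (intro divide_left_mono) auto
  then show ?thesis
    unfolding envelope_def by (intro add_mono order_refl)
qed

lemma integrable_envelope: "integrable lborel (envelope i \<sigma>)"
  unfolding envelope_def[abs_def]
  by (intro Bochner_Integration.integrable_add integrable_gaussian \<sigma> integrable_indicator_Icc)

lemma integrable_bump: "integrable lborel (bump i \<sigma>)"
  by (rule Bochner_Integration.integrable_bound[OF integrable_envelope])
    (simp_all add: borel_measurable_bump[OF \<sigma>] abs_of_nonneg[OF bump_nonneg]
      order_trans[OF bump_le_envelope abs_ge_self])

end

lemma integral_bump_le:
  assumes "i \<in> {1..<N}" "0 < \<sigma>" "\<sigma> \<le> 1"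
  shows "(LINT x|lborel. bump i \<sigma> x) \<le> (LINT x|lborel. envelope i 1 x)"
  by (rule integral_mono)
    (use assms in \<open>simp_all add: integrable_bump integrable_envelope order_trans[OF bump_le_envelope envelope_mono]\<close>)

section \<open>Pointwise limits of bumps and responsibilities\<close>

lemma bump_tendsto:
  assumes i: "i \<in> {1..<N}" and x: "x \<noteq> \<mu> i" "x \<noteq> \<mu> (i + 1)"
  shows "((\<lambda>\<sigma>. bump i \<sigma> x) \<longlongrightarrow> indicator {\<mu> i<..<\<mu> (i + 1)} x) (at_right 0)"
proof -
  have e: "((\<lambda>\<sigma>. exp (- (x - m)\<^sup>2 / (2 * \<sigma>\<^sup>2))) \<longlongrightarrow> 0) (at_right 0)" if "x \<noteq> m" for m
    using that by (intro exp_neg_div_square_tendsto_0) simp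
  consider "x < \<mu> i" | "\<mu> i < x" "x < \<mu> (i + 1)" | "x > \<mu> (i + 1)"
    using x by linarith
  then show ?thesis
  proof cases
    case 1
    have "((\<lambda>\<sigma>. bump i \<sigma> x) \<longlongrightarrow> 0) (at_right 0)"
      by (rule tendsto_sandwich_at_right[OF _ _ tendsto_const e[OF x(1)]])
        (use 1 bump_nonneg[OF i] bump_le_lower_tail[OF i] in auto)
    then show ?thesis using 1 by simp
  next
    case 2
    have "((\<lambda>\<sigma>. 1 - exp (- (x - \<mu> i)\<^sup>2 / (2 * \<sigma>\<^sup>2)) - exp (- (x - \<mu> (i + 1))\<^sup>2 / (2 * \<sigma>\<^sup>2))) \<longlongrightarrow> 1 - 0 - 0) (at_right 0)"
      by (intro tendsto_intros e x)
    then have lower: "((\<lambda>\<sigma>. 1 - exp (- (x - \<mu> i)\<^sup>2 / (2 * \<sigma>\<^sup>2)) - exp (- (x - \<mu> (i + 1))\<^sup>2 / (2 * \<sigma>\<^sup>2))) \<longlongrightarrow> 1) (at_right 0)"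
      by simp
    have "((\<lambda>\<sigma>. bump i \<sigma> x) \<longlongrightarrow> 1) (at_right 0)"
      by (rule tendsto_sandwich_at_right[OF bump_ge[OF i] bump_le_1[OF i] lower tendsto_const]) (use 2 in auto)
    then show ?thesis using 2 by simp
  next
    case 3
    then have "\<mu> i < x" using i mean_mono[of i "i + 1"] by simp
    have "((\<lambda>\<sigma>. bump i \<sigma> x) \<longlongrightarrow> 0) (at_right 0)"
      by (rule tendsto_sandwich_at_right[OF _ _ tendsto_const e[OF x(2)]])
        (use 3 bump_nonneg[OF i] bump_le_upper_tail[OF i] in auto)
    then show ?thesis using 3 by simp
  qed
qed

text \<open>The ratio of components \<open>j\<close> and \<open>k\<close> is
  \<open>p j / p k\<close> times \<open>exp (- c / (2 * \<sigma>^2))\<close>, with \<open>c\<close>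
  the difference of the squared distances, positive because \<open>\<mu> k\<close> is nearer; the
  remaining factor \<open>resp k\<close> is at most 1.\<close>

lemma resp_tendsto_0:
  assumes "k \<in> {1..N}" "j \<in> {1..N}" and near: "\<bar>x - \<mu> k\<bar> < \<bar>x - \<mu> j\<bar>"
  shows "((\<lambda>\<sigma>. resp j \<sigma> x) \<longlongrightarrow> 0) (at_right 0)"
proof -
  define c where "c = (x - \<mu> j)\<^sup>2 - (x - \<mu> k)\<^sup>2"
  have c: "c > 0"
    using power_strict_mono[OF near, of 2] by (simp add: c_def)
  have bound: "resp j \<sigma> x \<le> p j / p k * exp (- c / (2 * \<sigma>\<^sup>2))" if \<sigma>: "\<sigma> > 0" for \<sigma>
  proof -
    have "normal_density (\<mu> j) \<sigma> x = exp (- c / (2 * \<sigma>\<^sup>2)) * normal_density (\<mu> k) \<sigma> x"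
      unfolding normal_density_eq_exp times_divide_eq_right exp_add[symmetric] add_divide_distrib[symmetric]
      by (simp add: c_def)
    then have "resp j \<sigma> x = p j / p k * exp (- c / (2 * \<sigma>\<^sup>2)) * resp k \<sigma> x"
      using weight_pos[OF assms(1)] by (simp add: resp_def)
    also have "\<dots> \<le> p j / p k * exp (- c / (2 * \<sigma>\<^sup>2)) * 1"
      using weight_pos assms(1,2) \<sigma> by (intro mult_left_mono resp_le_1) (auto simp: less_imp_le)
    finally show ?thesis by simp
  qed
  have "((\<lambda>\<sigma>. p j / p k * exp (- c / (2 * \<sigma>\<^sup>2))) \<longlongrightarrow> p j / p k * 0) (at_right 0)"
    by (intro tendsto_intros exp_neg_div_square_tendsto_0 c)
  then have upper: "((\<lambda>\<sigma>. p j / p k * exp (- c / (2 * \<sigma>\<^sup>2))) \<longlongrightarrow> 0) (at_right 0)"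
    by simp
  show ?thesis
    by (rule tendsto_sandwich_at_right[OF resp_nonneg[OF assms(2)] bound tendsto_const upper])
qed

text \<open>The nearest mean takes all the mass: the other responsibilities vanish, and its own is 1
  minus their sum.\<close>

lemma resp_tendsto:
  assumes k: "k \<in> {1..N}" and j: "j \<in> {1..N}"
    and near: "\<And>l. l \<in> {1..N} \<Longrightarrow> l \<noteq> k \<Longrightarrow> \<bar>x - \<mu> k\<bar> < \<bar>x - \<mu> l\<bar>"
  shows "((\<lambda>\<sigma>. resp j \<sigma> x) \<longlongrightarrow> (if j = k then 1 else 0)) (at_right 0)"
proof (cases "j = k")
  case False
  then show ?thesis
    using resp_tendsto_0[OF k j near[OF j]] by simp
next
  case True
  have "((\<lambda>\<sigma>. 1 - (\<Sum>l \<in> {1..N} - {k}. resp l \<sigma> x)) \<longlongrightarrow> 1 - (\<Sum>l \<in> {1..N} - {k}. 0)) (at_right 0)"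
    using near by (intro tendsto_intros resp_tendsto_0[OF k]) auto
  then have "((\<lambda>\<sigma>. 1 - (\<Sum>l \<in> {1..N} - {k}. resp l \<sigma> x)) \<longlongrightarrow> 1) (at_right 0)"
    by simp
  moreover have "\<forall>\<^sub>F \<sigma> in at_right 0. 1 - (\<Sum>l \<in> {1..N} - {k}. resp l \<sigma> x) = resp k \<sigma> x"
    using eventually_at_right_less[of "0::real"]
  proof eventually_elim
    case (elim \<sigma>)
    have "resp k \<sigma> x + (\<Sum>l \<in> {1..N} - {k}. resp l \<sigma> x) = 1"
      using k sum_resp[OF elim, of x] sum.remove[of "{1..N}" k "\<lambda>l. resp l \<sigma> x"] by simp
    then show ?case by simp
  qed
  ultimately show ?thesis
    using True by (simp add: Lim_transform_eventually)
qed

section \<open>The limit integrals\<close>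

lemma component_resp_bounds:
  assumes "\<sigma> > 0" "i \<in> {1..N}" "j \<in> {1..N}"
  shows "0 \<le> p i * normal_density (\<mu> i) \<sigma> x * resp j \<sigma> x"
    and "p i * normal_density (\<mu> i) \<sigma> x * resp j \<sigma> x \<le> p i * normal_density (\<mu> i) \<sigma> x"
proof -
  have "p i * normal_density (\<mu> i) \<sigma> x \<ge> 0"
    using weight_pos[OF assms(2)] by simp
  then show "0 \<le> p i * normal_density (\<mu> i) \<sigma> x * resp j \<sigma> x"
    and "p i * normal_density (\<mu> i) \<sigma> x * resp j \<sigma> x \<le> p i * normal_density (\<mu> i) \<sigma> x"
    using resp_nonneg[OF assms(3), of \<sigma> x] resp_le_1[OF assms(1,3), of x] by (simp_all add: mult_left_le)
qed

lemma integrable_component_resp: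
  assumes "\<sigma> > 0" "i \<in> {1..N}" "j \<in> {1..N}"
  shows "integrable lborel (\<lambda>x. p i * normal_density (\<mu> i) \<sigma> x * resp j \<sigma> x)"
proof (rule Bochner_Integration.integrable_bound)
  show "integrable lborel (\<lambda>x. p i * normal_density (\<mu> i) \<sigma> x)"
    using assms by simp
  show "AE x in lborel. norm (p i * normal_density (\<mu> i) \<sigma> x * resp j \<sigma> x)
      \<le> norm (p i * normal_density (\<mu> i) \<sigma> x)"
    by (intro AE_I2) (simp only: real_norm_def abs_of_nonneg[OF component_resp_bounds(1)[OF assms]]
        order_trans[OF component_resp_bounds(2)[OF assms] abs_ge_self])
qed measurable

text \<open>If \<open>a, b \<le> D\<close> and \<open>a * b = c\<^sup>2\<close> with \<open>c \<ge> 0\<close>, then \<open>c \<le> D\<close> and hence \<open>a * b / D \<le> c\<close>.\<close>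

lemma component_resp_le:
  assumes \<sigma>: "\<sigma> > 0" and i: "i \<in> {1..N}" and j: "j \<in> {1..N}"
  shows "p i * normal_density (\<mu> i) \<sigma> x * resp j \<sigma> x
    \<le> sqrt (p i * p j) * exp (- (\<mu> i - \<mu> j)\<^sup>2 / (8 * \<sigma>\<^sup>2)) * normal_density ((\<mu> i + \<mu> j) / 2) \<sigma> x"
    (is "_ \<le> ?c")
proof -
  let ?a = "p i * normal_density (\<mu> i) \<sigma> x" and ?b = "p j * normal_density (\<mu> j) \<sigma> x"
  have c: "?c \<ge> 0" and ab: "?a \<ge> 0" "?b \<ge> 0"
    using weight_pos[OF i] weight_pos[OF j] by (simp_all add: less_imp_le)
  have "?a * ?b = (p i * p j) * (normal_density (\<mu> i) \<sigma> x * normal_density (\<mu> j) \<sigma> x)"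
    by (simp only: mult_ac)
  also have "p i * p j = (sqrt (p i * p j))\<^sup>2"
    using weight_pos[OF i] weight_pos[OF j] by simp
  finally have sq: "?a * ?b = ?c\<^sup>2"
    unfolding normal_density_product_eq[OF \<sigma>] by (simp only: power_mult_distrib mult.assoc)
  have D: "dens \<sigma> x > 0"
    by (rule dens_pos[OF \<sigma> i])
  have "?c\<^sup>2 \<le> (dens \<sigma> x)\<^sup>2"
    unfolding sq[symmetric] power2_eq_square[of "dens \<sigma> x"]
    using ab D by (intro mult_mono component_le_dens i j) auto
  then have "?c \<le> dens \<sigma> x"
    by (rule power2_le_imp_le) (rule less_imp_le[OF D])
  then have "?c * ?c \<le> ?c * dens \<sigma> x"
    by (rule mult_left_mono) (rule c)
  then have "?a * ?b / dens \<sigma> x \<le> ?c"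
    unfolding sq power2_eq_square pos_divide_le_eq[OF D] .
  then show ?thesis
    by (simp add: resp_def mult_ac)
qed

lemma component_resp_integral_tendsto_0:
  assumes i: "i \<in> {1..N}" and j: "j \<in> {1..N}" and "i \<noteq> j"
  shows "((\<lambda>\<sigma>. LINT x|lborel. p i * normal_density (\<mu> i) \<sigma> x * resp j \<sigma> x) \<longlongrightarrow> 0) (at_right 0)"
proof -
  \<comment> \<open>The quarter turns the exponent denominator \<open>8 * \<sigma>^2\<close> of
    \<open>component_resp_le\<close> into the \<open>2 * \<sigma>^2\<close> of
    \<open>exp_neg_div_square_tendsto_0\<close>; the Gaussian at the midpoint integrates to
    1.\<close>
  let ?e = "\<lambda>\<sigma>. exp (- ((\<mu> i - \<mu> j)\<^sup>2 / 4) / (2 * \<sigma>\<^sup>2))"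
  have "\<mu> i \<noteq> \<mu> j"
    using mean_diff[OF i j] d_pos \<open>i \<noteq> j\<close> by auto
  then have "((\<lambda>\<sigma>. sqrt (p i * p j) * ?e \<sigma>) \<longlongrightarrow> sqrt (p i * p j) * 0) (at_right 0)"
    by (intro tendsto_intros exp_neg_div_square_tendsto_0) simp
  then have lim: "((\<lambda>\<sigma>. sqrt (p i * p j) * ?e \<sigma>) \<longlongrightarrow> 0) (at_right 0)"
    by simp
  show ?thesis
  proof (rule tendsto_sandwich_at_right[OF _ _ tendsto_const lim])
    fix \<sigma> :: real assume \<sigma>: "\<sigma> > 0"
    show "0 \<le> (LINT x|lborel. p i * normal_density (\<mu> i) \<sigma> x * resp j \<sigma> x)"
      by (rule Bochner_Integration.integral_nonneg) (rule component_resp_bounds(1)[OF \<sigma> i j])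
    have "(LINT x|lborel. p i * normal_density (\<mu> i) \<sigma> x * resp j \<sigma> x)
        \<le> (LINT x|lborel. sqrt (p i * p j) * exp (- (\<mu> i - \<mu> j)\<^sup>2 / (8 * \<sigma>\<^sup>2)) * normal_density ((\<mu> i + \<mu> j) / 2) \<sigma> x)"
      using \<sigma> by (intro integral_mono integrable_component_resp component_resp_le i j) auto
    also have "\<dots> = sqrt (p i * p j) * ?e \<sigma>"
      using \<sigma> by simp
    finally show "(LINT x|lborel. p i * normal_density (\<mu> i) \<sigma> x * resp j \<sigma> x) \<le> sqrt (p i * p j) * ?e \<sigma>" .
  qed
qed

text \<open>The row sums equal \<open>p i\<close>, so the diagonal limit follows from the off-diagonal ones.\<close>

lemma component_resp_integral_tendsto:
  assumes i: "i \<in> {1..N}" and j: "j \<in> {1..N}"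
  shows "((\<lambda>\<sigma>. LINT x|lborel. p i * normal_density (\<mu> i) \<sigma> x * resp j \<sigma> x)
    \<longlongrightarrow> (if i = j then p i else 0)) (at_right 0)"
proof (cases "i = j")
  case False
  then show ?thesis
    using component_resp_integral_tendsto_0[OF assms] by simp
next
  case True
  let ?I = "\<lambda>\<sigma> l. LINT x|lborel. p i * normal_density (\<mu> i) \<sigma> x * resp l \<sigma> x"
  have "((\<lambda>\<sigma>. p i - (\<Sum>l \<in> {1..N} - {i}. ?I \<sigma> l)) \<longlongrightarrow> p i - (\<Sum>l \<in> {1..N} - {i}. 0)) (at_right 0)"
    by (intro tendsto_intros component_resp_integral_tendsto_0 i) auto
  then have "((\<lambda>\<sigma>. p i - (\<Sum>l \<in> {1..N} - {i}. ?I \<sigma> l)) \<longlongrightarrow> p i) (at_right 0)"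
    by simp
  moreover have "\<forall>\<^sub>F \<sigma> in at_right 0. p i - (\<Sum>l \<in> {1..N} - {i}. ?I \<sigma> l) = ?I \<sigma> i"
    using eventually_at_right_less[of "0::real"]
  proof eventually_elim
    case (elim \<sigma>)
    have "?I \<sigma> i + (\<Sum>l \<in> {1..N} - {i}. ?I \<sigma> l) = (\<Sum>l \<in> {1..N}. ?I \<sigma> l)"
      using i by (simp add: sum.remove)
    also have "\<dots> = (LINT x|lborel. (\<Sum>l \<in> {1..N}. p i * normal_density (\<mu> i) \<sigma> x * resp l \<sigma> x))"
      by (rule Bochner_Integration.integral_sum[symmetric]) (rule integrable_component_resp[OF elim i])
    also have "\<dots> = (LINT x|lborel. p i * normal_density (\<mu> i) \<sigma> x)"
      using sum_resp[OF elim] i by (simp flip: sum_distrib_left)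
    also have "\<dots> = p i"
      using elim by simp
    finally show ?case by simp
  qed
  ultimately show ?thesis
    using True by (simp add: Lim_transform_eventually)
qed

section \<open>The \<open>\<theta>\<mu>\<close> block\<close>

lemma bump_resp_bounds:
  assumes "\<sigma> > 0" "i \<in> {1..<N}" "j \<in> {1..N}"
  shows "0 \<le> bump i \<sigma> x * resp j \<sigma> x" "bump i \<sigma> x * resp j \<sigma> x \<le> bump i \<sigma> x"
  using bump_nonneg[OF assms(2,1), of x] resp_nonneg[OF assms(3), of \<sigma> x] resp_le_1[OF assms(1,3), of x]
  by (simp_all add: mult_left_le)

lemma integrable_bump_resp:
  assumes "\<sigma> > 0" "i \<in> {1..<N}" "j \<in> {1..N}"
  shows "integrable lborel (\<lambda>x. bump i \<sigma> x * resp j \<sigma> x)"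
proof (rule Bochner_Integration.integrable_bound[OF integrable_bump[OF assms(2,1)]])
  show "(\<lambda>x. bump i \<sigma> x * resp j \<sigma> x) \<in> borel_measurable lborel"
    using borel_measurable_bump[OF assms(1), of i] by simp
  show "AE x in lborel. norm (bump i \<sigma> x * resp j \<sigma> x) \<le> norm (bump i \<sigma> x)"
    using bump_resp_bounds[OF assms] by (intro AE_I2) (simp add: order_trans[OF _ abs_ge_self])
qed

text \<open>In the limit the bump restricts to the interval between the two means, whose halves
  belong to the Voronoi cells of \<open>\<mu> i\<close> and \<open>\<mu> (i + 1)\<close>; each half
  has length \<open>d / 2\<close>, and no other cell meets its interior.\<close>

lemma bump_resp_integral_tendsto:
  assumes i: "i \<in> {1..<N}" and j: "j \<in> {1..N}"
  shows "((\<lambda>\<sigma>. LINT x|lborel. bump i \<sigma> x * resp j \<sigma> x)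
    \<longlongrightarrow> (if j = i \<or> j = i + 1 then d / 2 else 0)) (at_right 0)"
proof -
  define m where "m = \<mu> i + d / 2"
  have step: "\<mu> (i + 1) = \<mu> i + d"
    using spacing[OF i] by simp
  define f :: "real \<Rightarrow> real" where "f x = indicator {\<mu> i<..<m} x * of_bool (j = i) + indicator {m<..<\<mu> (i + 1)} x * of_bool (j = i + 1)" for x
  \<comment> \<open>Distinct means are at least \<open>d\<close> apart, so a point within
    \<open>d / 2\<close> of one of them is strictly nearer to it than to any other.\<close>
  have near: "\<bar>x - \<mu> k\<bar> < \<bar>x - \<mu> l\<bar>" if "k \<in> {1..N}" "l \<in> {1..N}" "l \<noteq> k" "\<bar>x - \<mu> k\<bar> < d / 2" for x k l
  proof -
    have "1 \<le> \<bar>real k - real l\<bar>"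
      using that(3) by linarith
    then have "d \<le> \<bar>real k - real l\<bar> * d"
      using d_pos by simp
    also have "\<dots> = \<bar>\<mu> k - \<mu> l\<bar>"
      using mean_diff[OF that(1,2)] d_pos by (simp add: abs_mult)
    finally show ?thesis
      using that(4) by linarith
  qed
  have "((\<lambda>\<sigma>. LINT x|lborel. bump i \<sigma> x * resp j \<sigma> x) \<longlongrightarrow> (LINT x|lborel. f x)) (at_right 0)"
  proof (rule integral_dominated_convergence_at_right_0)
    show "f \<in> borel_measurable lborel"
      unfolding f_def[abs_def] by measurable
    show "(\<lambda>x. bump i \<sigma> x * resp j \<sigma> x) \<in> borel_measurable lborel" if "\<sigma> > 0" for \<sigma>
      using borel_measurable_bump[OF that, of i] by simp
    show "integrable lborel (envelope i 1)"
      by (rule integrable_envelope[OF i]) simp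
    \<comment> \<open>A null set is discarded: the endpoints, where the bump limit is not covered,
      and the midpoint, where two means are equally near.\<close>
    have "AE x in lborel. x \<noteq> \<mu> i \<and> x \<noteq> \<mu> (i + 1) \<and> x \<noteq> m"
      by (intro AE_conjI AE_lborel_singleton)
    then show "AE x in lborel. ((\<lambda>\<sigma>. bump i \<sigma> x * resp j \<sigma> x) \<longlongrightarrow> f x) (at_right 0)"
    proof eventually_elim
      case (elim x)
      note bump = bump_tendsto[OF i, of x]
      consider "\<mu> i < x" "x < m" | "m < x" "x < \<mu> (i + 1)" | "x < \<mu> i \<or> \<mu> (i + 1) < x"
        using elim by linarith
      then show ?case
      proof cases
        case 1
        then have "\<bar>x - \<mu> i\<bar> < d / 2"
          by (simp add: m_def)
        then have "((\<lambda>\<sigma>. resp j \<sigma> x) \<longlongrightarrow> (if j = i then 1 else 0)) (at_right 0)"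
          using i j by (intro resp_tendsto near) auto
        from tendsto_mult[OF bump this] show ?thesis
          using 1 elim d_pos step by (simp add: f_def m_def of_bool_def)
      next
        case 2
        then have "\<bar>x - \<mu> (i + 1)\<bar> < d / 2"
          using step by (simp add: m_def)
        then have "((\<lambda>\<sigma>. resp j \<sigma> x) \<longlongrightarrow> (if j = i + 1 then 1 else 0)) (at_right 0)"
          using i j by (intro resp_tendsto near) auto
        from tendsto_mult[OF bump this] show ?thesis
          using 2 elim d_pos step by (simp add: f_def m_def of_bool_def)
      next
        case 3
        \<comment> \<open>Outside the interval no limit of the responsibility is required: it is at
          most 1 and the bump already vanishes.\<close>
        then have "indicator {\<mu> i<..<\<mu> (i + 1)} x = (0::real)" "f x = 0"
          using d_pos step by (auto simp: f_def m_def)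
        then have "((\<lambda>\<sigma>. bump i \<sigma> x) \<longlongrightarrow> 0) (at_right 0)" "f x = 0"
          using bump elim by auto
        then show ?thesis
          by (auto intro: tendsto_sandwich_at_right[OF bump_resp_bounds[OF _ i j] tendsto_const])
      qed
    qed
    show "\<forall>\<^sub>F \<sigma> in at_right 0. AE x in lborel. norm (bump i \<sigma> x * resp j \<sigma> x) \<le> envelope i 1 x"
      using eventually_at_right_0_1
    proof eventually_elim
      case (elim \<sigma>)
      have "norm (bump i \<sigma> x * resp j \<sigma> x) \<le> envelope i 1 x" for x
        using elim bump_resp_bounds[OF _ i j, of \<sigma> x] bump_le_envelope[OF i, of \<sigma> x] envelope_mono[OF i, of \<sigma> x]
        by simp
      then show ?case by simp
    qed
  qed
  also have "(LINT x|lborel. f x) = (if j = i \<or> j = i + 1 then d / 2 else 0)"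
    unfolding f_def using d_pos step by (auto simp: m_def)
  finally show ?thesis .
qed

section \<open>The \<open>\<theta>\<theta>\<close> block: contributions of order
  \<open>\<sigma>\<close> and integrability\<close>

lemma gaussian_times_div_dens_le:
  assumes "\<sigma> > 0" "k \<in> {1..N}" "b \<ge> 0" "a \<le> exp (- (x - \<mu> k)\<^sup>2 / (2 * \<sigma>\<^sup>2))"
  shows "a * b / dens \<sigma> x \<le> sqrt (2 * pi) * \<sigma> / p k * b"
proof -
  have "a * b / dens \<sigma> x \<le> exp (- (x - \<mu> k)\<^sup>2 / (2 * \<sigma>\<^sup>2)) / dens \<sigma> x * b"
    using assms dens_pos[OF assms(1,2), of x] by (simp add: divide_right_mono mult_right_mono)
  also have "\<dots> \<le> sqrt (2 * pi) * \<sigma> / p k * b"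
    by (rule mult_right_mono[OF gaussian_div_dens_le[OF assms(1,2)] assms(3)])
  finally show ?thesis .
qed

lemma bump_bump_nonneg:
  assumes "\<sigma> > 0" "i \<in> {1..<N}" "j \<in> {1..<N}"
  shows "bump i \<sigma> x * bump j \<sigma> x / dens \<sigma> x \<ge> 0"
  using bump_nonneg[OF assms(2,1)] bump_nonneg[OF assms(3,1)] dens_pos[OF assms(1), of 1 x] assms
  by (simp add: less_imp_le)

text \<open>The point \<open>\<mu> (i + 1)\<close> separates the two bumps, so at every \<open>x\<close> one of them is in its Gaussian tail
  and is absorbed by component \<open>i + 1\<close> of the density.\<close>

lemma bump_bump_div_dens_le:
  assumes \<sigma>: "\<sigma> > 0" and i: "i \<in> {1..<N}" and j: "j \<in> {1..<N}" and "i < j"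
  shows "bump i \<sigma> x * bump j \<sigma> x / dens \<sigma> x \<le> sqrt (2 * pi) * \<sigma> / p (i + 1) * (bump i \<sigma> x + bump j \<sigma> x)"
proof -
  let ?C = "sqrt (2 * pi) * \<sigma> / p (i + 1)"
  have k: "i + 1 \<in> {1..N}"
    using i by simp
  have nonneg: "bump i \<sigma> x \<ge> 0" "bump j \<sigma> x \<ge> 0" "?C \<ge> 0"
    using bump_nonneg i j \<sigma> weight_pos[OF k] by auto
  show ?thesis
  proof (cases "x \<le> \<mu> (i + 1)")
    case True
    have "\<mu> (i + 1) \<le> \<mu> j"
      using i j \<open>i < j\<close> by (intro mean_mono) auto
    then have "(x - \<mu> (i + 1))\<^sup>2 \<le> (x - \<mu> j)\<^sup>2"
      unfolding abs_le_square_iff[symmetric] using True by simp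
    then have "- (x - \<mu> j)\<^sup>2 / (2 * \<sigma>\<^sup>2) \<le> - (x - \<mu> (i + 1))\<^sup>2 / (2 * \<sigma>\<^sup>2)"
      by (intro divide_right_mono) auto
    then have "bump j \<sigma> x \<le> exp (- (x - \<mu> (i + 1))\<^sup>2 / (2 * \<sigma>\<^sup>2))"
      using bump_le_lower_tail[OF j \<sigma>, of x] True \<open>\<mu> (i + 1) \<le> \<mu> j\<close>
      by (meson exp_le_cancel_iff order_trans)
    then have "bump j \<sigma> x * bump i \<sigma> x / dens \<sigma> x \<le> ?C * bump i \<sigma> x"
      by (rule gaussian_times_div_dens_le[OF \<sigma> k nonneg(1)])
    then show ?thesis
      unfolding distrib_left mult.commute[of "bump j \<sigma> x"] using mult_nonneg_nonneg[OF nonneg(3,2)] by linarith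
  next
    case False
    then have "bump i \<sigma> x * bump j \<sigma> x / dens \<sigma> x \<le> ?C * bump j \<sigma> x"
      by (intro gaussian_times_div_dens_le[OF \<sigma> k nonneg(2)] bump_le_upper_tail[OF i \<sigma>]) simp
    then show ?thesis
      unfolding distrib_left using mult_nonneg_nonneg[OF nonneg(3,1)] by linarith
  qed
qed

text \<open>Left of the interval one factor \<open>bump\<close> is absorbed by component
  \<open>i\<close>, right of it by component \<open>i + 1\<close>; adding both constants covers
  either side.\<close>

lemma bump_sq_div_dens_outside_le:
  assumes \<sigma>: "\<sigma> > 0" and i: "i \<in> {1..<N}" and x: "x \<notin> {\<mu> i..\<mu> (i + 1)}"
  shows "bump i \<sigma> x * bump i \<sigma> x / dens \<sigma> x \<le> sqrt (2 * pi) * \<sigma> * (1 / p i + 1 / p (i + 1)) * bump i \<sigma> x"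
proof -
  have k: "i \<in> {1..N}" "i + 1 \<in> {1..N}"
    using i by auto
  have b: "bump i \<sigma> x \<ge> 0"
    by (rule bump_nonneg[OF i \<sigma>])
  have "bump i \<sigma> x * bump i \<sigma> x / dens \<sigma> x \<le> sqrt (2 * pi) * \<sigma> / p i * bump i \<sigma> x
    \<or> bump i \<sigma> x * bump i \<sigma> x / dens \<sigma> x \<le> sqrt (2 * pi) * \<sigma> / p (i + 1) * bump i \<sigma> x"
    using x gaussian_times_div_dens_le[OF \<sigma> k(1) b bump_le_lower_tail[OF i \<sigma>]]
      gaussian_times_div_dens_le[OF \<sigma> k(2) b bump_le_upper_tail[OF i \<sigma>]]
    by force
  moreover have "sqrt (2 * pi) * \<sigma> / p i * bump i \<sigma> x \<ge> 0" "sqrt (2 * pi) * \<sigma> / p (i + 1) * bump i \<sigma> x \<ge> 0"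
    using weight_pos[OF k(1)] weight_pos[OF k(2)] \<sigma> b by (simp_all add: less_imp_le)
  ultimately show ?thesis
    by (auto simp: distrib_left distrib_right)
qed

text \<open>Component \<open>i\<close> alone, at distance at most \<open>d\<close>, gives this crude
  bound. It exceeds the true order as \<open>\<sigma>\<close> tends to 0 and serves integrability at
  fixed \<open>\<sigma>\<close>.\<close>

lemma inverse_dens_inside_le:
  assumes \<sigma>: "\<sigma> > 0" and i: "i \<in> {1..<N}" and x: "x \<in> {\<mu> i..\<mu> (i + 1)}"
  shows "1 / dens \<sigma> x \<le> sqrt (2 * pi) * \<sigma> / p i * exp (d\<^sup>2 / (2 * \<sigma>\<^sup>2))"
proof -
  have k: "i \<in> {1..N}"
    using i by simp
  have "(x - \<mu> i)\<^sup>2 \<le> d\<^sup>2"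
    using x spacing[OF i] d_pos by (intro power_mono) auto
  then have "exp (- d\<^sup>2 / (2 * \<sigma>\<^sup>2)) \<le> exp (- (x - \<mu> i)\<^sup>2 / (2 * \<sigma>\<^sup>2))"
    unfolding exp_le_cancel_iff by (intro divide_right_mono) auto
  from gaussian_times_div_dens_le[OF \<sigma> k _ this, of "exp (d\<^sup>2 / (2 * \<sigma>\<^sup>2))"] show ?thesis
    by (simp add: exp_minus)
qed

text \<open>On the diagonal, the bounds inside and outside the interval are multiples of the
  integrable \<open>bump\<close>. Off the diagonal, \<open>a * b \<le> a^2 + b^2\<close> for
  nonnegative \<open>a\<close>, \<open>b\<close> reduces to two diagonal cases.\<close>

lemma integrable_bump_bump:
  assumes \<sigma>: "\<sigma> > 0" and i: "i \<in> {1..<N}" and j: "j \<in> {1..<N}"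
  shows "integrable lborel (\<lambda>x. bump i \<sigma> x * bump j \<sigma> x / dens \<sigma> x)"
proof -
  have meas: "(\<lambda>x. bump i \<sigma> x * bump j \<sigma> x / dens \<sigma> x) \<in> borel_measurable lborel" for i j
    using borel_measurable_bump[OF \<sigma>, of i] borel_measurable_bump[OF \<sigma>, of j] by simp
  have diag: "integrable lborel (\<lambda>x. bump i \<sigma> x * bump i \<sigma> x / dens \<sigma> x)"
    if i: "i \<in> {1..<N}" for i
  proof -
    let ?A = "sqrt (2 * pi) * \<sigma> * (1 / p i + 1 / p (i + 1))"
    let ?B = "sqrt (2 * pi) * \<sigma> / p i * exp (d\<^sup>2 / (2 * \<sigma>\<^sup>2))"
    have A: "?A \<ge> 0" and B: "?B \<ge> 0"
      using i \<sigma> weight_pos[of i] weight_pos[of "i + 1"] by simp_all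
    have "bump i \<sigma> x * bump i \<sigma> x / dens \<sigma> x \<le> (?A + ?B) * bump i \<sigma> x" for x
    proof (cases "x \<in> {\<mu> i..\<mu> (i + 1)}")
      case True
      have b: "bump i \<sigma> x \<ge> 0" "bump i \<sigma> x \<le> 1"
        using bump_nonneg[OF i \<sigma>] bump_le_1[OF i \<sigma>] by auto
      have "bump i \<sigma> x * bump i \<sigma> x / dens \<sigma> x = (bump i \<sigma> x * bump i \<sigma> x) * (1 / dens \<sigma> x)"
        by simp
      also have "\<dots> \<le> (bump i \<sigma> x * 1) * ?B"
        using b B by (intro mult_mono inverse_dens_inside_le[OF \<sigma> i True])
          (auto intro!: divide_nonneg_nonneg less_imp_le[OF dens_pos[OF \<sigma>, of i]] simp: i[simplified] less_imp_le)
      also have "\<dots> = ?B * bump i \<sigma> x"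
        by (simp only: mult_1_right mult.commute)
      also have "\<dots> \<le> (?A + ?B) * bump i \<sigma> x"
        unfolding distrib_right[of ?A] using mult_nonneg_nonneg[OF A b(1)] by linarith
      finally show ?thesis .
    next
      case False
      have "bump i \<sigma> x \<ge> 0"
        by (rule bump_nonneg[OF i \<sigma>])
      from mult_nonneg_nonneg[OF B this] bump_sq_div_dens_outside_le[OF \<sigma> i False]
      show ?thesis
        unfolding distrib_right[of ?A] by linarith
    qed
    then show ?thesis
      by (intro Bochner_Integration.integrable_bound[OF integrable_mult_right[OF integrable_bump[OF i \<sigma>], of "?A + ?B"] meas] AE_I2)
        (simp only: real_norm_def abs_of_nonneg[OF bump_bump_nonneg[OF \<sigma> i i]] order_trans[OF _ abs_ge_self])
  qed
  have "bump i \<sigma> x * bump j \<sigma> x / dens \<sigma> x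
    \<le> bump i \<sigma> x * bump i \<sigma> x / dens \<sigma> x + bump j \<sigma> x * bump j \<sigma> x / dens \<sigma> x" for x
  proof -
    have "bump i \<sigma> x * bump j \<sigma> x \<le> bump i \<sigma> x * bump i \<sigma> x + bump j \<sigma> x * bump j \<sigma> x"
      using mult_nonneg_nonneg[OF bump_nonneg[OF i \<sigma>] bump_nonneg[OF j \<sigma>], of x x]
        zero_le_square[of "bump i \<sigma> x - bump j \<sigma> x"]
      by (simp add: algebra_simps)
    then show ?thesis
      unfolding add_divide_distrib[symmetric] using i dens_pos[OF \<sigma>, of 1 x]
      by (intro divide_right_mono) auto
  qed
  then show ?thesis
    by (intro Bochner_Integration.integrable_bound[OF Bochner_Integration.integrable_add[OF diag[OF i] diag[OF j]] meas] AE_I2)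
      (simp only: real_norm_def abs_of_nonneg[OF bump_bump_nonneg[OF \<sigma> i j]] order_trans[OF _ abs_ge_self])
qed

text \<open>The pointwise bound carries a factor \<open>\<sigma>\<close>, and the masses of the
  bumps are bounded uniformly by the envelopes at 1, so the integral is of order
  \<open>\<sigma>\<close>.\<close>

lemma bump_bump_integral_tendsto_0:
  assumes i: "i \<in> {1..<N}" and j: "j \<in> {1..<N}" and "i < j"
  shows "((\<lambda>\<sigma>. (LINT x|lborel. bump i \<sigma> x * bump j \<sigma> x / dens \<sigma> x) / wim_scale d \<sigma>) \<longlongrightarrow> 0) (at_right 0)"
proof -
  let ?B = "(LINT x|lborel. envelope i 1 x) + (LINT x|lborel. envelope j 1 x)"
  let ?c = "sqrt (2 * pi) / p (i + 1) * ?B"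
  have p: "p (i + 1) > 0"
    using i by (intro weight_pos) auto
  have "((\<lambda>\<sigma>. ?c * (\<sigma> / wim_scale d \<sigma>)) \<longlongrightarrow> ?c * 0) (at_right 0)"
    by (intro tendsto_intros sigma_div_wim_scale_tendsto d_pos)
  then have lim: "((\<lambda>\<sigma>. ?c * (\<sigma> / wim_scale d \<sigma>)) \<longlongrightarrow> 0) (at_right 0)"
    by simp
  show ?thesis
  proof (rule tendsto_sandwich[OF _ _ tendsto_const lim])
    show "\<forall>\<^sub>F \<sigma> in at_right 0. 0 \<le> (LINT x|lborel. bump i \<sigma> x * bump j \<sigma> x / dens \<sigma> x) / wim_scale d \<sigma>"
      using eventually_at_right_0_1
    proof eventually_elim
      case (elim \<sigma>)
      show ?case
        by (intro divide_nonneg_nonneg[OF Bochner_Integration.integral_nonneg] bump_bump_nonneg i j)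
          (use elim d_pos in \<open>auto simp: wim_scale_eq\<close>)
    qed
    show "\<forall>\<^sub>F \<sigma> in at_right 0. (LINT x|lborel. bump i \<sigma> x * bump j \<sigma> x / dens \<sigma> x) / wim_scale d \<sigma>
        \<le> ?c * (\<sigma> / wim_scale d \<sigma>)"
      using eventually_at_right_0_1
    proof eventually_elim
      case (elim \<sigma>)
      then have \<sigma>: "\<sigma> > 0" "\<sigma> \<le> 1"
        by auto
      have "(LINT x|lborel. bump i \<sigma> x * bump j \<sigma> x / dens \<sigma> x)
          \<le> (LINT x|lborel. sqrt (2 * pi) * \<sigma> / p (i + 1) * (bump i \<sigma> x + bump j \<sigma> x))"
        by (intro integral_mono integrable_bump_bump integrable_mult_right Bochner_Integration.integrable_add
            integrable_bump bump_bump_div_dens_le \<sigma> assms)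
      also have "\<dots> = sqrt (2 * pi) * \<sigma> / p (i + 1) * ((LINT x|lborel. bump i \<sigma> x) + (LINT x|lborel. bump j \<sigma> x))"
        using integrable_bump[OF i \<sigma>(1)] integrable_bump[OF j \<sigma>(1)] by simp
      also have "\<dots> \<le> sqrt (2 * pi) * \<sigma> / p (i + 1) * ?B"
        using \<sigma> p by (intro mult_left_mono add_mono integral_bump_le i j) auto
      also have "\<dots> = ?c * \<sigma>"
        by simp
      finally have "(LINT x|lborel. bump i \<sigma> x * bump j \<sigma> x / dens \<sigma> x) / wim_scale d \<sigma> \<le> ?c * \<sigma> / wim_scale d \<sigma>"
        using \<sigma> d_pos by (intro divide_right_mono) (auto simp: wim_scale_eq)
      then show ?case
        by simp
    qed
  qed
qed

section \<open>The \<open>\<theta>\<theta>\<close> block: rescaling at the midpoint\<close>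

text \<open>The density at the point \<open>\<sigma>\<^sup>2 / d * t\<close> away from the midpoint of \<open>\<mu> i\<close> and \<open>\<mu> (i + 1)\<close>,
  up to the factor in \<open>dens_rescaled\<close>.\<close>

definition profile :: "nat \<Rightarrow> real \<Rightarrow> real \<Rightarrow> real" where
  "profile i \<sigma> t = (\<Sum>k = 1..N. p k *
     exp ((real k - real i - 1 / 2) * t - (real k - real i) * (real k - real i - 1) * d\<^sup>2 / (2 * \<sigma>\<^sup>2)))"

text \<open>Components \<open>i\<close> and \<open>i + 1\<close> are equally high at the midpoint;
  extracting this height frees their exponents in \<open>profile\<close> of \<open>\<sigma>\<close>.
  The term quadratic in \<open>t\<close> is common to all components because the variances
  agree.\<close>

lemma dens_rescaled:
  assumes i: "i \<in> {1..<N}" and \<sigma>: "\<sigma> > 0"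
  shows "dens \<sigma> (\<mu> i + d / 2 + \<sigma>\<^sup>2 / d * t)
    = profile i \<sigma> t / (sqrt (2 * pi) * \<sigma> * exp (d\<^sup>2 / (8 * \<sigma>\<^sup>2)) * exp (\<sigma>\<^sup>2 * t\<^sup>2 / (2 * d\<^sup>2)))"
proof -
  have component: "normal_density (\<mu> k) \<sigma> (\<mu> i + d / 2 + \<sigma>\<^sup>2 / d * t)
      = exp ((real k - real i - 1 / 2) * t - (real k - real i) * (real k - real i - 1) * d\<^sup>2 / (2 * \<sigma>\<^sup>2))
        / (sqrt (2 * pi) * \<sigma> * exp (d\<^sup>2 / (8 * \<sigma>\<^sup>2)) * exp (\<sigma>\<^sup>2 * t\<^sup>2 / (2 * d\<^sup>2)))"
    if k: "k \<in> {1..N}" for k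
  proof -
    let ?A = "(real k - real i - 1 / 2) * t - (real k - real i) * (real k - real i - 1) * d\<^sup>2 / (2 * \<sigma>\<^sup>2)"
    let ?B = "d\<^sup>2 / (8 * \<sigma>\<^sup>2)" and ?C = "\<sigma>\<^sup>2 * t\<^sup>2 / (2 * d\<^sup>2)"
    \<comment> \<open>The signed distance of \<open>\<mu> k\<close> from the midpoint in units of
      \<open>d\<close>; expanding the square around it separates the three exponents.\<close>
    define c where "c = real k - real i - 1 / 2"
    have "\<mu> i - \<mu> k = (real i - real k) * d"
      using i k by (intro mean_diff) auto
    then have "\<mu> i + d / 2 + \<sigma>\<^sup>2 / d * t - \<mu> k = \<sigma>\<^sup>2 / d * t - c * d"
      by (simp add: c_def algebra_simps)
    then have "- (\<mu> i + d / 2 + \<sigma>\<^sup>2 / d * t - \<mu> k)\<^sup>2 / (2 * \<sigma>\<^sup>2) = - (\<sigma>\<^sup>2 / d * t - c * d)\<^sup>2 / (2 * \<sigma>\<^sup>2)"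
      by (rule arg_cong)
    also have "\<dots> = c * t - (c\<^sup>2 - 1 / 4) * d\<^sup>2 / (2 * \<sigma>\<^sup>2) - (d\<^sup>2 / (8 * \<sigma>\<^sup>2) + \<sigma>\<^sup>2 * t\<^sup>2 / (2 * d\<^sup>2))"
      using \<sigma> d_pos by (simp add: field_simps power2_eq_square)
    also have "c\<^sup>2 - 1 / 4 = (real k - real i) * (real k - real i - 1)"
      by (simp add: c_def power2_eq_square algebra_simps)
    finally have "exp (- (\<mu> i + d / 2 + \<sigma>\<^sup>2 / d * t - \<mu> k)\<^sup>2 / (2 * \<sigma>\<^sup>2)) = exp (?A - (?B + ?C))"
      unfolding c_def by (rule arg_cong)
    also have "\<dots> = exp ?A / (exp ?B * exp ?C)"
      by (simp only: exp_diff[of ?A] exp_add[of ?B])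
    finally show ?thesis
      unfolding normal_density_eq_exp using \<sigma> by (simp add: real_sqrt_mult)
  qed
  show ?thesis
    unfolding dens_def profile_def sum_divide_distrib
    by (intro sum.cong) (simp_all only: component times_divide_eq_right)
qed

text \<open>Dropping all but the two adjacent components leaves a lower bound free of
  \<open>\<sigma>\<close>, from which both positivity and the majorant for the rescaled integrand
  follow.\<close>

lemma profile_ge:
  assumes i: "i \<in> {1..<N}"
  shows "p i * exp (- (1 / 2 * t)) + p (i + 1) * exp (1 / 2 * t) \<le> profile i \<sigma> t"
proof -
  let ?f = "\<lambda>k. p k * exp ((real k - real i - 1 / 2) * t - (real k - real i) * (real k - real i - 1) * d\<^sup>2 / (2 * \<sigma>\<^sup>2))"
  have "p i * exp (- (1 / 2 * t)) + p (i + 1) * exp (1 / 2 * t) = sum ?f {i, i + 1}"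
    by simp
  also have "\<dots> \<le> sum ?f {1..N}"
    using i by (intro sum_mono2) (auto intro!: mult_nonneg_nonneg less_imp_le[OF weight_pos])
  finally show ?thesis
    by (simp add: profile_def)
qed

text \<open>For an integer \<open>k - i\<close> other than 0 and 1 the product
  \<open>(k - i) * (k - i - 1)\<close> is positive, so every nonadjacent component is exponentially
  small at fixed \<open>t\<close>.\<close>

lemma profile_tendsto:
  assumes i: "i \<in> {1..<N}"
  shows "((\<lambda>\<sigma>. profile i \<sigma> t) \<longlongrightarrow> p i * exp (- (1 / 2 * t)) + p (i + 1) * exp (1 / 2 * t)) (at_right 0)"
proof -
  let ?l = "\<lambda>k. (if k = i then p i * exp (- (1 / 2 * t)) else 0) + (if k = i + 1 then p (i + 1) * exp (1 / 2 * t) else 0)"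
  have "((\<lambda>\<sigma>. p k * exp ((real k - real i - 1 / 2) * t - (real k - real i) * (real k - real i - 1) * d\<^sup>2 / (2 * \<sigma>\<^sup>2)))
      \<longlongrightarrow> ?l k) (at_right 0)" for k
  proof (cases "k = i \<or> k = i + 1")
    case True
    then show ?thesis by (auto intro: tendsto_eq_intros)
  next
    case False
    then consider "real k - real i \<le> - 1" | "real k - real i \<ge> 2"
      by linarith
    then have "(real k - real i) * (real k - real i - 1) > 0"
      by cases (auto intro: mult_neg_neg mult_pos_pos)
    then have "(real k - real i) * (real k - real i - 1) * d\<^sup>2 > 0"
      using d_pos by simp
    then have "((\<lambda>\<sigma>. p k * (exp ((real k - real i - 1 / 2) * t) *
        exp (- ((real k - real i) * (real k - real i - 1) * d\<^sup>2) / (2 * \<sigma>\<^sup>2))))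
        \<longlongrightarrow> p k * (exp ((real k - real i - 1 / 2) * t) * 0)) (at_right 0)"
      by (intro tendsto_intros exp_neg_div_square_tendsto_0)
    then show ?thesis
      using False by (simp flip: exp_add)
  qed
  then have "((\<lambda>\<sigma>. profile i \<sigma> t) \<longlongrightarrow> (\<Sum>k = 1..N. ?l k)) (at_right 0)"
    unfolding profile_def by (intro tendsto_sum)
  also have "(\<Sum>k = 1..N. ?l k) = p i * exp (- (1 / 2 * t)) + p (i + 1) * exp (1 / 2 * t)"
    using i by (simp add: sum.distrib)
  finally show ?thesis .
qed

lemma eventually_rescaled_near_midpoint: "\<forall>\<^sub>F \<sigma> in at_right 0. \<bar>\<sigma>\<^sup>2 / d * t\<bar> < d / 4"
proof -
  have "((\<lambda>\<sigma>. \<bar>\<sigma>\<^sup>2 / d * t\<bar>) \<longlongrightarrow> \<bar>0\<^sup>2 / d * t\<bar>) (at_right 0)"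
    using d_pos by (intro tendsto_intros) auto
  then show ?thesis
    by (rule order_tendstoD(2)) (use d_pos in simp)
qed

text \<open>At fixed \<open>t\<close> the rescaled point eventually stays at distance at least
  \<open>d / 4\<close> from both means, so both tails in \<open>bump_ge\<close> vanish.\<close>

lemma bump_rescaled_tendsto:
  assumes i: "i \<in> {1..<N}"
  shows "((\<lambda>\<sigma>. bump i \<sigma> (\<mu> i + d / 2 + \<sigma>\<^sup>2 / d * t)) \<longlongrightarrow> 1) (at_right 0)"
proof -
  have step: "\<mu> (i + 1) = \<mu> i + d"
    using spacing[OF i] by simp
  let ?e = "\<lambda>\<sigma>. exp (- (d / 4)\<^sup>2 / (2 * \<sigma>\<^sup>2))"
  have "((\<lambda>\<sigma>. 1 - ?e \<sigma> - ?e \<sigma>) \<longlongrightarrow> 1 - 0 - 0) (at_right 0)"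
    using d_pos by (intro tendsto_intros exp_neg_div_square_tendsto_0) simp_all
  then have lower: "((\<lambda>\<sigma>. 1 - ?e \<sigma> - ?e \<sigma>) \<longlongrightarrow> 1) (at_right 0)"
    by simp
  show ?thesis
  proof (rule tendsto_sandwich[OF _ _ lower tendsto_const])
    show "\<forall>\<^sub>F \<sigma> in at_right 0. bump i \<sigma> (\<mu> i + d / 2 + \<sigma>\<^sup>2 / d * t) \<le> 1"
      using eventually_at_right_less[of 0] by eventually_elim (rule bump_le_1[OF i])
    show "\<forall>\<^sub>F \<sigma> in at_right 0. 1 - ?e \<sigma> - ?e \<sigma> \<le> bump i \<sigma> (\<mu> i + d / 2 + \<sigma>\<^sup>2 / d * t)"
      using eventually_at_right_less[of 0] eventually_rescaled_near_midpoint[of t]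
    proof eventually_elim
      case (elim \<sigma>)
      define x where "x = \<mu> i + d / 2 + \<sigma>\<^sup>2 / d * t"
      have x: "\<mu> i + d / 4 \<le> x" "x \<le> \<mu> (i + 1) - d / 4"
        using elim(2) step unfolding x_def by linarith+
      have "exp (- (x - m)\<^sup>2 / (2 * \<sigma>\<^sup>2)) \<le> ?e \<sigma>" if "d / 4 \<le> \<bar>x - m\<bar>" for m
      proof -
        have "(d / 4)\<^sup>2 \<le> (x - m)\<^sup>2"
          unfolding abs_le_square_iff[symmetric] using that d_pos by simp
        then show ?thesis
          unfolding exp_le_cancel_iff by (intro divide_right_mono) auto
      qed
      from this[of "\<mu> i"] this[of "\<mu> (i + 1)"] x d_pos
      show ?case
        using bump_ge[OF i elim(1), of x] unfolding x_def[symmetric] by linarith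
    qed
  qed
qed

text \<open>After the change of variables to \<open>t\<close>, dominated convergence leaves the
  integral of \<open>1 / (p i * exp (- t / 2) + p (i + 1) * exp (t / 2))\<close>, divided by
  \<open>pi\<close>.\<close>

lemma bump_sq_inside_integral_tendsto:
  assumes i: "i \<in> {1..<N}"
  shows "((\<lambda>\<sigma>. (LINT x|lborel. indicator {\<mu> i..\<mu> (i + 1)} x * (bump i \<sigma> x * bump i \<sigma> x / dens \<sigma> x)) / wim_scale d \<sigma>)
    \<longlongrightarrow> 1 / sqrt (p i * p (i + 1))) (at_right 0)"
proof -
  have p: "p i > 0" "p (i + 1) > 0"
    using i by (auto intro!: weight_pos)
  have step: "\<mu> (i + 1) = \<mu> i + d"
    using spacing[OF i] by simp
  let ?S = "{\<mu> i..\<mu> (i + 1)}"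
  define X where "X \<sigma> t = \<mu> i + d / 2 + \<sigma>\<^sup>2 / d * t" for \<sigma> t
  \<comment> \<open>The indicator stays inside \<open>g\<close>: the growing factor
    \<open>exp (...)\<close>, inherited from the denominator in \<open>dens_rescaled\<close>, is
    controlled only while \<open>X\<close> remains in the interval.\<close>
  define g where "g \<sigma> t = indicator ?S (X \<sigma> t) * (bump i \<sigma> (X \<sigma> t) * bump i \<sigma> (X \<sigma> t) *
      exp (\<sigma>\<^sup>2 * t\<^sup>2 / (2 * d\<^sup>2)) / profile i \<sigma> t)" for \<sigma> t :: real
  define f where "f t = 1 / (p i * exp (- (1 / 2 * t)) + p (i + 1) * exp (1 / 2 * t))" for t
  \<comment> \<open>\<open>profile_ge\<close> with both weights replaced by their minimum, combined
    with \<open>exp_quarter_div_le\<close>; the result decays like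
    \<open>exp (- |t| / 4)\<close>.\<close>
  define w where "w t = 1 / min (p i) (p (i + 1)) * (2 * (1 / (1 * exp (- (1 / 4 * t)) + 1 * exp (1 / 4 * t))))" for t :: real
  \<comment> \<open>The Jacobian and the constant extracted in \<open>dens_rescaled\<close> make up
    \<open>wim_scale\<close> except for its factor \<open>pi\<close>.\<close>
  have substitution: "(LINT x|lborel. indicator ?S x * (bump i \<sigma> x * bump i \<sigma> x / dens \<sigma> x)) / wim_scale d \<sigma>
      = 1 / pi * (LINT t|lborel. g \<sigma> t)" if \<sigma>: "\<sigma> > 0" for \<sigma>
  proof -
    let ?K = "sqrt (2 * pi) * \<sigma> * exp (d\<^sup>2 / (8 * \<sigma>\<^sup>2))"
    have K: "?K > 0"
      using \<sigma> by simp
    have "(LINT x|lborel. indicator ?S x * (bump i \<sigma> x * bump i \<sigma> x / dens \<sigma> x))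
        = \<sigma>\<^sup>2 / d * (LINT t|lborel. indicator ?S (X \<sigma> t) * (bump i \<sigma> (X \<sigma> t) * bump i \<sigma> (X \<sigma> t) / dens \<sigma> (X \<sigma> t)))"
      using \<sigma> d_pos unfolding X_def
      by (subst lborel_integral_real_affine[of "\<sigma>\<^sup>2 / d" _ "\<mu> i + d / 2"]) simp_all
    also have "\<dots> = \<sigma>\<^sup>2 / d * (LINT t|lborel. ?K * g \<sigma> t)"
      unfolding X_def g_def dens_rescaled[OF i \<sigma>] by (simp add: mult_ac)
    also have "\<dots> = (?K * (\<sigma>\<^sup>2 / d)) * (LINT t|lborel. g \<sigma> t)"
      by simp
    also have "\<dots> / wim_scale d \<sigma> = 1 / pi * (LINT t|lborel. g \<sigma> t)"
      using K \<sigma> d_pos unfolding wim_scale_eq by simp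
    finally show ?thesis .
  qed
  have profile_pos: "profile i \<sigma> t > 0" for \<sigma> t
    by (rule less_le_trans[OF _ profile_ge[OF i]]) (use p in \<open>simp add: add_pos_pos\<close>)
  have "((\<lambda>\<sigma>. LINT t|lborel. g \<sigma> t) \<longlongrightarrow> (LINT t|lborel. f t)) (at_right 0)"
  proof (rule integral_dominated_convergence_at_right_0)
    show "f \<in> borel_measurable lborel"
      unfolding f_def[abs_def] by measurable
    show "integrable lborel w"
      unfolding w_def[abs_def] by (intro integrable_mult_right integrable_inverse_exp_sum) auto
    show "g \<sigma> \<in> borel_measurable lborel" if \<sigma>: "\<sigma> > 0" for \<sigma>
    proof -
      note [measurable] = borel_measurable_bump[OF \<sigma>, of i]
      show ?thesis
        unfolding g_def[abs_def] X_def profile_def by measurable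
    qed
    show "AE t in lborel. ((\<lambda>\<sigma>. g \<sigma> t) \<longlongrightarrow> f t) (at_right 0)"
    proof (rule AE_I2)
      fix t :: real
      have "((\<lambda>\<sigma>. bump i \<sigma> (X \<sigma> t) * bump i \<sigma> (X \<sigma> t) * exp (\<sigma>\<^sup>2 * t\<^sup>2 / (2 * d\<^sup>2)) / profile i \<sigma> t)
          \<longlongrightarrow> 1 * 1 * exp (0\<^sup>2 * t\<^sup>2 / (2 * d\<^sup>2)) / (p i * exp (- (1 / 2 * t)) + p (i + 1) * exp (1 / 2 * t))) (at_right 0)"
        unfolding X_def using d_pos add_pos_pos[OF mult_pos_pos[OF p(1) exp_gt_zero] mult_pos_pos[OF p(2) exp_gt_zero], of "- (1 / 2 * t)" "1 / 2 * t"]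
        by (intro tendsto_intros bump_rescaled_tendsto i profile_tendsto) auto
      then have "((\<lambda>\<sigma>. bump i \<sigma> (X \<sigma> t) * bump i \<sigma> (X \<sigma> t) * exp (\<sigma>\<^sup>2 * t\<^sup>2 / (2 * d\<^sup>2)) / profile i \<sigma> t) \<longlongrightarrow> f t) (at_right 0)"
        by (simp add: f_def)
      moreover have "\<forall>\<^sub>F \<sigma> in at_right 0. bump i \<sigma> (X \<sigma> t) * bump i \<sigma> (X \<sigma> t) * exp (\<sigma>\<^sup>2 * t\<^sup>2 / (2 * d\<^sup>2)) / profile i \<sigma> t = g \<sigma> t"
        using eventually_rescaled_near_midpoint[of t]
      proof eventually_elim
        case (elim \<sigma>)
        then have "X \<sigma> t \<in> ?S"
          using step d_pos unfolding X_def atLeastAtMost_iff by (intro conjI) linarith+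
        then show ?case
          by (simp add: g_def)
      qed
      ultimately show "((\<lambda>\<sigma>. g \<sigma> t) \<longlongrightarrow> f t) (at_right 0)"
        by (rule Lim_transform_eventually)
    qed
    have "norm (g \<sigma> t) \<le> w t" if \<sigma>: "\<sigma> > 0" for \<sigma> t
    proof (cases "X \<sigma> t \<in> ?S")
      case True
      let ?m = "min (p i) (p (i + 1))"
      have m: "?m > 0"
        using p by simp
      have b: "bump i \<sigma> (X \<sigma> t) \<ge> 0" "bump i \<sigma> (X \<sigma> t) \<le> 1"
        using bump_nonneg[OF i \<sigma>] bump_le_1[OF i \<sigma>] by auto
      \<comment> \<open>Inside the interval the offset from the midpoint is at most
        \<open>d / 2\<close>. Spending this on one factor of the square turns the quadratic exponent
        into \<open>|t| / 4\<close>, half of the decay \<open>|t| / 2\<close> supplied by the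
        profile.\<close>
      have "\<bar>\<sigma>\<^sup>2 / d * t\<bar> \<le> d / 2"
        using True step unfolding X_def atLeastAtMost_iff by linarith
      then have "\<bar>\<sigma>\<^sup>2 / d * t\<bar> * (\<bar>t\<bar> / (2 * d)) \<le> d / 2 * (\<bar>t\<bar> / (2 * d))"
        using d_pos by (intro mult_right_mono) auto
      moreover have "\<bar>\<sigma>\<^sup>2 / d * t\<bar> * (\<bar>t\<bar> / (2 * d)) = \<sigma>\<^sup>2 * t\<^sup>2 / (2 * d\<^sup>2)"
        using d_pos by (simp add: abs_mult power2_eq_square)
      moreover have "d / 2 * (\<bar>t\<bar> / (2 * d)) = \<bar>t\<bar> / 4"
        using d_pos by simp
      ultimately have e: "exp (\<sigma>\<^sup>2 * t\<^sup>2 / (2 * d\<^sup>2)) \<le> exp (\<bar>t\<bar> / 4)"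
        by simp
      have "?m * (exp (- (t / 2)) + exp (t / 2)) \<le> p i * exp (- (1 / 2 * t)) + p (i + 1) * exp (1 / 2 * t)"
        unfolding distrib_left by (intro add_mono mult_mono) (use p in auto)
      also have "\<dots> \<le> profile i \<sigma> t"
        by (rule profile_ge[OF i])
      finally have P: "?m * (exp (- (t / 2)) + exp (t / 2)) \<le> profile i \<sigma> t" .
      have "norm (g \<sigma> t) = (bump i \<sigma> (X \<sigma> t) * bump i \<sigma> (X \<sigma> t)) * exp (\<sigma>\<^sup>2 * t\<^sup>2 / (2 * d\<^sup>2)) / profile i \<sigma> t"
        using True profile_pos[of \<sigma> t] by (simp add: g_def abs_mult)
      also have "\<dots> \<le> 1 * exp (\<bar>t\<bar> / 4) / (?m * (exp (- (t / 2)) + exp (t / 2)))"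
        using b e P m by (intro frac_le mult_mono mult_le_one) (auto intro!: mult_pos_pos add_pos_pos)
      also have "\<dots> = 1 / ?m * (exp (\<bar>t\<bar> / 4) / (exp (- (t / 2)) + exp (t / 2)))"
        by simp
      also have "\<dots> \<le> w t"
        unfolding w_def using m by (intro mult_left_mono exp_quarter_div_le) auto
      finally show ?thesis .
    next
      case False
      have "w t \<ge> 0"
        using p by (simp add: w_def add_nonneg_nonneg)
      then show ?thesis
        using False by (simp add: g_def)
    qed
    then show "\<forall>\<^sub>F \<sigma> in at_right 0. AE t in lborel. norm (g \<sigma> t) \<le> w t"
      by (intro eventually_mono[OF eventually_at_right_less[of 0]] AE_I2)
  qed
  then have "((\<lambda>\<sigma>. 1 / pi * (LINT t|lborel. g \<sigma> t)) \<longlongrightarrow> 1 / pi * (LINT t|lborel. f t)) (at_right 0)"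
    by (intro tendsto_intros)
  also have "(LINT t|lborel. f t) = pi / (2 * (1 / 2) * sqrt (p i * p (i + 1)))"
    unfolding f_def using p by (intro integral_inverse_exp_sum) auto
  finally have "((\<lambda>\<sigma>. 1 / pi * (LINT t|lborel. g \<sigma> t)) \<longlongrightarrow> 1 / sqrt (p i * p (i + 1))) (at_right 0)"
    by simp
  then show ?thesis
    by (rule Lim_transform_eventually)
      (use substitution in \<open>auto intro: eventually_mono[OF eventually_at_right_less[of 0]]\<close>)
qed

text \<open>Splitting at the two means leaves the whole limit to the inside; the outside is of order
  \<open>\<sigma>\<close> because its Gaussian tails are absorbed.\<close>

lemma bump_sq_integral_tendsto:
  assumes i: "i \<in> {1..<N}"
  shows "((\<lambda>\<sigma>. (LINT x|lborel. bump i \<sigma> x * bump i \<sigma> x / dens \<sigma> x) / wim_scale d \<sigma>)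
    \<longlongrightarrow> 1 / sqrt (p i * p (i + 1))) (at_right 0)"
proof -
  let ?S = "{\<mu> i..\<mu> (i + 1)}"
  let ?f = "\<lambda>\<sigma> x. bump i \<sigma> x * bump i \<sigma> x / dens \<sigma> x"
  let ?out = "\<lambda>\<sigma>. LINT x|lborel. indicator (- ?S) x * ?f \<sigma> x"
  let ?q = "1 / p i + 1 / p (i + 1)"
  let ?c = "sqrt (2 * pi) * ?q * (LINT x|lborel. envelope i 1 x)"
  have q: "?q \<ge> 0"
    using weight_pos[of i] weight_pos[of "i + 1"] i by simp
  have int: "integrable lborel (\<lambda>x. indicator A x * ?f \<sigma> x)" if "\<sigma> > 0" "A \<in> sets borel" for \<sigma> A
    using integrable_mult_indicator[OF _ integrable_bump_bump[OF that(1) i i], of A] that by simp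
  have "((\<lambda>\<sigma>. ?c * (\<sigma> / wim_scale d \<sigma>)) \<longlongrightarrow> ?c * 0) (at_right 0)"
    by (intro tendsto_intros sigma_div_wim_scale_tendsto d_pos)
  then have lim: "((\<lambda>\<sigma>. ?c * (\<sigma> / wim_scale d \<sigma>)) \<longlongrightarrow> 0) (at_right 0)"
    by simp
  have "((\<lambda>\<sigma>. ?out \<sigma> / wim_scale d \<sigma>) \<longlongrightarrow> 0) (at_right 0)"
  proof (rule tendsto_sandwich[OF _ _ tendsto_const lim])
    show "\<forall>\<^sub>F \<sigma> in at_right 0. 0 \<le> ?out \<sigma> / wim_scale d \<sigma>"
      using eventually_at_right_0_1
    proof eventually_elim
      case (elim \<sigma>)
      show ?case
        by (intro divide_nonneg_nonneg[OF Bochner_Integration.integral_nonneg] mult_nonneg_nonneg bump_bump_nonneg i)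
          (use elim d_pos in \<open>auto simp: wim_scale_eq\<close>)
    qed
    show "\<forall>\<^sub>F \<sigma> in at_right 0. ?out \<sigma> / wim_scale d \<sigma> \<le> ?c * (\<sigma> / wim_scale d \<sigma>)"
      using eventually_at_right_0_1
    proof eventually_elim
      case (elim \<sigma>)
      then have \<sigma>: "\<sigma> > 0" "\<sigma> \<le> 1"
        by auto
      have C: "sqrt (2 * pi) * \<sigma> * ?q \<ge> 0"
        using \<sigma> q by (intro mult_nonneg_nonneg) auto
      have "?out \<sigma> \<le> (LINT x|lborel. sqrt (2 * pi) * \<sigma> * ?q * bump i \<sigma> x)"
      proof (intro integral_mono int integrable_mult_right integrable_bump i \<sigma>)
        show "indicator (- ?S) x * ?f \<sigma> x \<le> sqrt (2 * pi) * \<sigma> * ?q * bump i \<sigma> x" for x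
          using bump_sq_div_dens_outside_le[OF \<sigma>(1) i, of x] mult_nonneg_nonneg[OF C bump_nonneg[OF i \<sigma>(1)], of x]
          by (cases "x \<in> ?S") simp_all
      qed simp
      also have "\<dots> = sqrt (2 * pi) * \<sigma> * ?q * (LINT x|lborel. bump i \<sigma> x)"
        by simp
      also have "\<dots> \<le> sqrt (2 * pi) * \<sigma> * ?q * (LINT x|lborel. envelope i 1 x)"
        by (intro mult_left_mono[OF integral_bump_le[OF i \<sigma>] C])
      also have "\<dots> = ?c * \<sigma>"
        by simp
      finally have "?out \<sigma> / wim_scale d \<sigma> \<le> ?c * \<sigma> / wim_scale d \<sigma>"
        using \<sigma> d_pos by (intro divide_right_mono) (auto simp: wim_scale_eq)
      then show ?case
        by simp
    qed
  qed
  from tendsto_add[OF bump_sq_inside_integral_tendsto[OF i] this]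
  have "((\<lambda>\<sigma>. (LINT x|lborel. indicator ?S x * ?f \<sigma> x) / wim_scale d \<sigma> + ?out \<sigma> / wim_scale d \<sigma>)
      \<longlongrightarrow> 1 / sqrt (p i * p (i + 1))) (at_right 0)"
    by simp
  moreover have "\<forall>\<^sub>F \<sigma> in at_right 0. (LINT x|lborel. indicator ?S x * ?f \<sigma> x) / wim_scale d \<sigma> + ?out \<sigma> / wim_scale d \<sigma>
      = (LINT x|lborel. ?f \<sigma> x) / wim_scale d \<sigma>"
    using eventually_at_right_less[of 0]
  proof eventually_elim
    case (elim \<sigma>)
    have "(LINT x|lborel. ?f \<sigma> x) = (LINT x|lborel. indicator ?S x * ?f \<sigma> x + indicator (- ?S) x * ?f \<sigma> x)"
      by (intro Bochner_Integration.integral_cong) (auto simp: indicator_def)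
    also have "\<dots> = (LINT x|lborel. indicator ?S x * ?f \<sigma> x) + ?out \<sigma>"
      by (intro Bochner_Integration.integral_add int elim) auto
    finally show ?case
      by (simp add: add_divide_distrib)
  qed
  ultimately show ?thesis
    by (rule Lim_transform_eventually)
qed

end

section \<open>The Wasserstein information matrix\<close>

lemma
  fixes f :: "'i \<Rightarrow> 'a \<Rightarrow> 'b::{banach, second_countable_topology}"
  assumes "\<And>i. i \<in> I \<Longrightarrow> set_integrable M A (f i)"
  shows set_integrable_sum: "set_integrable M A (\<lambda>x. \<Sum>i\<in>I. f i x)"
    and set_integral_sum: "(LINT x:A|M. \<Sum>i\<in>I. f i x) = (\<Sum>i\<in>I. LINT x:A|M. f i x)"
  using assms unfolding set_integrable_def set_lebesgue_integral_def
  by (simp_all add: scaleR_sum_right Bochner_Integration.integral_sum)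

text \<open>Here each \<open>\<theta> j\<close> occurs linearly in a single summand. Since
  \<open>\<theta>\<close> is arbitrary, the formula also applies to \<open>\<theta>(j := t)\<close>
  when differentiating.\<close>

lemma gmm_cdf_eq:
  assumes "\<sigma> > 0"
  shows "gmm_cdf N \<theta> \<mu> \<sigma> x =
    (\<Sum>i = 1..N - 1. \<theta> i * (gauss_cdf (\<mu> (i + 1)) \<sigma> x - gauss_cdf (\<mu> i) \<sigma> x)) + gauss_cdf (\<mu> 1) \<sigma> x"
  unfolding gmm_cdf_def gmm_density_def gauss_cdf_def
  using set_integrable_normal_density[OF assms, of "{..x}"]
  by (simp add: set_integral_add set_integral_sum set_integrable_sum set_integral_diff)

text \<open>Here each mean occurs in a single summand, which suits differentiation in
  \<open>\<mu> i\<close>; the boundary values of \<open>\<theta>\<close> stay fixed there.\<close>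

lemma gmm_cdf_eq_mixture:
  assumes "\<sigma> > 0" "N \<ge> 1" "\<theta> 0 = 1" "\<theta> N = 0"
  shows "gmm_cdf N \<theta> \<mu> \<sigma> x = (\<Sum>i = 1..N. gmm_weight \<theta> i * gauss_cdf (\<mu> i) \<sigma> x)"
  unfolding gmm_cdf_def gmm_density_eq_mixture[OF assms(2-4)] gauss_cdf_def
  using set_integrable_normal_density[OF assms(1), of "{..x}"]
  by (simp add: set_integral_sum)

lemma gmm_cdf_partial_Theta:
  assumes "\<sigma> > 0" "j \<in> {1..<N}"
  shows "gmm_cdf_partial N \<theta> \<mu> \<sigma> (Theta j) x = gauss_cdf (\<mu> (j + 1)) \<sigma> x - gauss_cdf (\<mu> j) \<sigma> x"
proof -
  let ?D = "\<lambda>i. gauss_cdf (\<mu> (i + 1)) \<sigma> x - gauss_cdf (\<mu> i) \<sigma> x"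
  have "((\<lambda>t. (\<Sum>i = 1..N - 1. (\<theta>(j := t)) i * ?D i) + gauss_cdf (\<mu> 1) \<sigma> x)
      has_real_derivative (\<Sum>i = 1..N - 1. (if i = j then 1 else 0) * ?D i) + 0) (at (\<theta> j))"
    by (intro DERIV_add DERIV_sum DERIV_const DERIV_cmult_right) auto
  also have "(\<Sum>i = 1..N - 1. (if i = j then 1 else 0) * ?D i) + 0 = (\<Sum>i = 1..N - 1. if i = j then ?D i else 0)"
    unfolding add_0_right by (intro sum.cong) auto
  also have "\<dots> = ?D j"
    using assms(2) by (subst sum.delta) auto
  finally show ?thesis
    using assms(1) by (simp only: gmm_cdf_partial.simps gmm_cdf_eq DERIV_imp_deriv)
qed

lemma gmm_cdf_partial_Mu:
  assumes "\<sigma> > 0" "i \<in> {1..N}" "\<theta> 0 = 1" "\<theta> N = 0"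
  shows "gmm_cdf_partial N \<theta> \<mu> \<sigma> (Mu i) x = - (gmm_weight \<theta> i * normal_density (\<mu> i) \<sigma> x)"
proof -
  let ?f = "\<lambda>k. if k = i then - (gmm_weight \<theta> i * normal_density (\<mu> i) \<sigma> x) else 0"
  have "((\<lambda>t. gmm_weight \<theta> k * gauss_cdf ((\<mu>(i := t)) k) \<sigma> x) has_real_derivative ?f k) (at (\<mu> i))" for k
    using DERIV_cmult[OF gauss_cdf_has_derivative_mean[OF assms(1), of x "\<mu> i"], of "gmm_weight \<theta> i"]
    by (cases "k = i") auto
  then have "((\<lambda>t. \<Sum>k = 1..N. gmm_weight \<theta> k * gauss_cdf ((\<mu>(i := t)) k) \<sigma> x)
      has_real_derivative (\<Sum>k = 1..N. ?f k)) (at (\<mu> i))"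
    by (intro DERIV_sum)
  also have "(\<Sum>k = 1..N. ?f k) = - (gmm_weight \<theta> i * normal_density (\<mu> i) \<sigma> x)"
    using assms(2) by (subst sum.delta) auto
  finally have deriv: "((\<lambda>t. \<Sum>k = 1..N. gmm_weight \<theta> k * gauss_cdf ((\<mu>(i := t)) k) \<sigma> x)
      has_real_derivative - (gmm_weight \<theta> i * normal_density (\<mu> i) \<sigma> x)) (at (\<mu> i))" .
  have "N \<ge> 1"
    using assms(2) by simp
  then show ?thesis
    using deriv by (simp only: gmm_cdf_partial.simps gmm_cdf_eq_mixture[OF assms(1) _ assms(3,4)] DERIV_imp_deriv)
qed

section \<open>Parameter indices and blocks\<close>

lemma length_gmm_params: "N \<ge> 1 \<Longrightarrow> length (gmm_params N) = (N - 1) + N"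
  by (simp add: gmm_params_def)

lemma gmm_params_nth_Theta: "k < N - 1 \<Longrightarrow> gmm_params N ! k = Theta (k + 1)"
  by (simp add: gmm_params_def nth_append)

lemma gmm_params_nth_Mu: "k < N \<Longrightarrow> gmm_params N ! (N - 1 + k) = Mu (k + 1)"
  using nth_append_length_plus[of "map Theta [1..<N]" "map Mu [1..<N + 1]" k]
  by (simp add: gmm_params_def del: upt_Suc)

lemma wim_integrand_commute: "wim_integrand N \<theta> \<mu> \<sigma> a b = wim_integrand N \<theta> \<mu> \<sigma> b a"
  by (simp add: wim_integrand_def mult.commute fun_eq_iff)

text \<open>The prescribed dimensions fix where the blocks meet, so each block entry is an entry of
  the assembled matrix. Block positions count from 0 and parameters from 1, hence the
  shifts.\<close>

lemma wasserstein_information_matrix_block_entries: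
  assumes W: "wasserstein_information_matrix N \<theta> \<mu> \<sigma> = four_block_mat A B C D"
    and "A \<in> carrier_mat (N - 1) (N - 1)" "B \<in> carrier_mat (N - 1) N"
      "C \<in> carrier_mat N (N - 1)" "D \<in> carrier_mat N N"
    and N: "N \<ge> 1"
  shows "i < N - 1 \<Longrightarrow> j < N - 1 \<Longrightarrow>
      A $$ (i, j) = (LINT x|lborel. wim_integrand N \<theta> \<mu> \<sigma> (Theta (i + 1)) (Theta (j + 1)) x)"
    and "i < N - 1 \<Longrightarrow> j < N \<Longrightarrow>
      B $$ (i, j) = (LINT x|lborel. wim_integrand N \<theta> \<mu> \<sigma> (Theta (i + 1)) (Mu (j + 1)) x)"
    and "i < N \<Longrightarrow> j < N - 1 \<Longrightarrow>
      C $$ (i, j) = (LINT x|lborel. wim_integrand N \<theta> \<mu> \<sigma> (Mu (i + 1)) (Theta (j + 1)) x)"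
    and "i < N \<Longrightarrow> j < N \<Longrightarrow>
      D $$ (i, j) = (LINT x|lborel. wim_integrand N \<theta> \<mu> \<sigma> (Mu (i + 1)) (Mu (j + 1)) x)"
proof -
  have entry: "four_block_mat A B C D $$ (k, l)
      = (LINT x|lborel. wim_integrand N \<theta> \<mu> \<sigma> (gmm_params N ! k) (gmm_params N ! l) x)"
    if "k < N - 1 + N" "l < N - 1 + N" for k l
    unfolding W[symmetric] wasserstein_information_matrix_def length_gmm_params[OF N]
    using that by simp
  have block: "four_block_mat A B C D $$ (k, l) = (if k < N - 1
      then if l < N - 1 then A $$ (k, l) else B $$ (k, l - (N - 1))
      else if l < N - 1 then C $$ (k - (N - 1), l) else D $$ (k - (N - 1), l - (N - 1)))"
    if "k < N - 1 + N" "l < N - 1 + N" for k l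
    using assms(2-5) that by (subst index_mat_four_block) auto
  note index_simps = gmm_params_nth_Theta gmm_params_nth_Mu trans_less_add1 nat_add_left_cancel_less
    not_add_less1 add_diff_cancel_left' if_True if_False simp_thms
  show "i < N - 1 \<Longrightarrow> j < N - 1 \<Longrightarrow>
      A $$ (i, j) = (LINT x|lborel. wim_integrand N \<theta> \<mu> \<sigma> (Theta (i + 1)) (Theta (j + 1)) x)"
    using entry[of i j] block[of i j] by (simp only: index_simps)
  show "i < N - 1 \<Longrightarrow> j < N \<Longrightarrow>
      B $$ (i, j) = (LINT x|lborel. wim_integrand N \<theta> \<mu> \<sigma> (Theta (i + 1)) (Mu (j + 1)) x)"
    using entry[of i "N - 1 + j"] block[of i "N - 1 + j"]
    by (simp only: index_simps)
  show "i < N \<Longrightarrow> j < N - 1 \<Longrightarrow>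
      C $$ (i, j) = (LINT x|lborel. wim_integrand N \<theta> \<mu> \<sigma> (Mu (i + 1)) (Theta (j + 1)) x)"
    using entry[of "N - 1 + i" j] block[of "N - 1 + i" j]
    by (simp only: index_simps)
  show "i < N \<Longrightarrow> j < N \<Longrightarrow>
      D $$ (i, j) = (LINT x|lborel. wim_integrand N \<theta> \<mu> \<sigma> (Mu (i + 1)) (Mu (j + 1)) x)"
    using entry[of "N - 1 + i" "N - 1 + j"] block[of "N - 1 + i" "N - 1 + j"]
    by (simp only: index_simps)
qed

text \<open>Integrability is part of the conclusion because the Bochner integral of a nonintegrable
  function is 0 by default; it certifies that the entries are genuine integrals.\<close>

theorem theorem6:
  fixes N :: nat and d :: real and \<theta> \<mu> :: "nat \<Rightarrow> real"
    and G\<theta>\<theta> G\<theta>\<mu> G\<mu>\<theta> G\<mu>\<mu> :: "real \<Rightarrow> real mat"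
  assumes N: "N \<ge> 2"
    and d: "d > 0"
    and theta_ends: "\<theta> 0 = 1" "\<theta> N = 0"
    and theta_decreasing: "\<And>i. i < N \<Longrightarrow> \<theta> (i + 1) < \<theta> i"
    and mu_spacing: "\<And>i. 1 \<le> i \<Longrightarrow> i \<le> N - 1 \<Longrightarrow> \<mu> (i + 1) - \<mu> i = d"
    and block_dims:
      "\<And>\<sigma>. \<sigma> > 0 \<Longrightarrow> G\<theta>\<theta> \<sigma> \<in> carrier_mat (N - 1) (N - 1)"
      "\<And>\<sigma>. \<sigma> > 0 \<Longrightarrow> G\<theta>\<mu> \<sigma> \<in> carrier_mat (N - 1) N"
      "\<And>\<sigma>. \<sigma> > 0 \<Longrightarrow> G\<mu>\<theta> \<sigma> \<in> carrier_mat N (N - 1)"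
      "\<And>\<sigma>. \<sigma> > 0 \<Longrightarrow> G\<mu>\<mu> \<sigma> \<in> carrier_mat N N"
    and blocks: "\<And>\<sigma>. \<sigma> > 0 \<Longrightarrow>
      wasserstein_information_matrix N \<theta> \<mu> \<sigma> =
        four_block_mat (G\<theta>\<theta> \<sigma>) (G\<theta>\<mu> \<sigma>) (G\<mu>\<theta> \<sigma>) (G\<mu>\<mu> \<sigma>)"
  shows "(\<forall>\<sigma>>0. \<forall>a \<in> set (gmm_params N). \<forall>b \<in> set (gmm_params N).
            integrable lborel (wim_integrand N \<theta> \<mu> \<sigma> a b))
    \<and> (\<forall>\<sigma>>0. G\<theta>\<mu> \<sigma> = transpose_mat (G\<mu>\<theta> \<sigma>))
    \<and> mat_tendsto (\<lambda>\<sigma>. (1 / wim_scale d \<sigma>) \<cdot>\<^sub>m G\<theta>\<theta> \<sigma>)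
        (mat_diag (N - 1) (\<lambda>i. 1 / sqrt (gmm_weight \<theta> (i + 1) * gmm_weight \<theta> (i + 2)))) (at_right 0)
    \<and> mat_tendsto G\<mu>\<mu> (mat_diag N (\<lambda>i. gmm_weight \<theta> (i + 1))) (at_right 0)
    \<and> mat_tendsto G\<theta>\<mu>
        (Matrix.mat (N - 1) N
          (\<lambda>(i, j). if j = i \<or> j = i + 1 then (\<mu> (i + 2) - \<mu> (i + 1)) / 2 else 0)) (at_right 0)"
proof -
  \<comment> \<open>Monotonicity includes the boundary values \<open>\<theta> 0\<close> and
    \<open>\<theta> N\<close>, so the first and last weights are positive too.\<close>
  have weight_pos: "gmm_weight \<theta> k > 0" if "k \<in> {1..N}" for k
    using theta_decreasing[of "k - 1"] that by (cases k) (auto simp: gmm_weight_def)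
  interpret gaussian_mixture N "gmm_weight \<theta>" \<mu> d
    using weight_pos d mu_spacing by unfold_locales auto
  have N1: "N \<ge> 1"
    using N by simp
  have dens: "gmm_density N \<theta> \<mu> \<sigma> x = dens \<sigma> x" for \<sigma> x
    unfolding gmm_density_eq_mixture[of N \<theta>, OF N1 theta_ends] dens_def ..
  \<comment> \<open>All derivatives of the distribution function carry a minus sign here, which
    cancels in the products of this and the next two identities.\<close>
  have TT: "wim_integrand N \<theta> \<mu> \<sigma> (Theta i) (Theta j) = (\<lambda>x. bump i \<sigma> x * bump j \<sigma> x / dens \<sigma> x)"
    if "\<sigma> > 0" "i \<in> {1..<N}" "j \<in> {1..<N}" for \<sigma> i j
    unfolding wim_integrand_def gmm_cdf_partial_Theta[OF that(1,2)] gmm_cdf_partial_Theta[OF that(1,3)] dens bump_def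
    by (simp add: algebra_simps)
  have TM: "wim_integrand N \<theta> \<mu> \<sigma> (Theta i) (Mu j) = (\<lambda>x. bump i \<sigma> x * resp j \<sigma> x)"
    if "\<sigma> > 0" "i \<in> {1..<N}" "j \<in> {1..N}" for \<sigma> i j
    unfolding wim_integrand_def gmm_cdf_partial_Theta[OF that(1,2)]
      gmm_cdf_partial_Mu[of \<sigma> j N \<theta>, OF that(1,3) theta_ends] dens bump_def resp_def
    by (simp add: left_diff_distrib)
  have MM: "wim_integrand N \<theta> \<mu> \<sigma> (Mu i) (Mu j) = (\<lambda>x. gmm_weight \<theta> i * normal_density (\<mu> i) \<sigma> x * resp j \<sigma> x)"
    if "\<sigma> > 0" "i \<in> {1..N}" "j \<in> {1..N}" for \<sigma> i j
    unfolding wim_integrand_def gmm_cdf_partial_Mu[of \<sigma> i N \<theta>, OF that(1,2) theta_ends]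
      gmm_cdf_partial_Mu[of \<sigma> j N \<theta>, OF that(1,3) theta_ends] dens resp_def
    by simp
  have params: "a \<in> Theta ` {1..<N} \<union> Mu ` {1..N}" if "a \<in> set (gmm_params N)" for a
    using that by (auto simp: gmm_params_def less_Suc_eq_le)
  have integrable: "integrable lborel (wim_integrand N \<theta> \<mu> \<sigma> a b)"
    if "\<sigma> > 0" "a \<in> set (gmm_params N)" "b \<in> set (gmm_params N)" for \<sigma> a b
    using params[OF that(2)] params[OF that(3)]
  proof (elim UnE imageE)
    fix i j assume "a = Theta i" "i \<in> {1..<N}" "b = Theta j" "j \<in> {1..<N}"
    then show ?thesis
      using TT integrable_bump_bump that(1) by simp
  next
    fix i j assume "a = Theta i" "i \<in> {1..<N}" "b = Mu j" "j \<in> {1..N}"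
    then show ?thesis
      using TM integrable_bump_resp that(1) by simp
  next
    fix i j assume "a = Mu i" "i \<in> {1..N}" "b = Theta j" "j \<in> {1..<N}"
    then show ?thesis
      unfolding wim_integrand_commute[of _ _ _ _ a] using TM integrable_bump_resp that(1) by simp
  next
    fix i j assume "a = Mu i" "i \<in> {1..N}" "b = Mu j" "j \<in> {1..N}"
    then show ?thesis
      using MM integrable_component_resp that(1) by simp
  qed
  note entries = wasserstein_information_matrix_block_entries[OF blocks block_dims N1]
  have transpose: "G\<theta>\<mu> \<sigma> = transpose_mat (G\<mu>\<theta> \<sigma>)" if \<sigma>: "\<sigma> > 0" for \<sigma>
    using block_dims[OF \<sigma>]
    by (intro eq_matI) (auto simp: entries(2,3)[OF \<sigma> \<sigma> \<sigma> \<sigma> \<sigma>] wim_integrand_commute[of _ _ _ _ "Theta _"])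
  note pos = eventually_at_right_less[of "0::real"]
  have "mat_tendsto (\<lambda>\<sigma>. (1 / wim_scale d \<sigma>) \<cdot>\<^sub>m G\<theta>\<theta> \<sigma>)
        (mat_diag (N - 1) (\<lambda>i. 1 / sqrt (gmm_weight \<theta> (i + 1) * gmm_weight \<theta> (i + 2)))) (at_right 0)"
    unfolding mat_tendsto_def
  proof (intro conjI allI impI)
    show "\<forall>\<^sub>F \<sigma> in at_right 0. (1 / wim_scale d \<sigma>) \<cdot>\<^sub>m G\<theta>\<theta> \<sigma> \<in> carrier_mat
        (dim_row (mat_diag (N - 1) (\<lambda>i. 1 / sqrt (gmm_weight \<theta> (i + 1) * gmm_weight \<theta> (i + 2)))))
        (dim_col (mat_diag (N - 1) (\<lambda>i. 1 / sqrt (gmm_weight \<theta> (i + 1) * gmm_weight \<theta> (i + 2)))))"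
      using pos by eventually_elim (use block_dims(1) in \<open>simp add: mat_diag_def\<close>)
    fix i j
    assume "i < dim_row (mat_diag (N - 1) (\<lambda>i. 1 / sqrt (gmm_weight \<theta> (i + 1) * gmm_weight \<theta> (i + 2))))"
      "j < dim_col (mat_diag (N - 1) (\<lambda>i. 1 / sqrt (gmm_weight \<theta> (i + 1) * gmm_weight \<theta> (i + 2))))"
    then have ij: "i < N - 1" "j < N - 1"
      by (simp_all add: mat_diag_def)
    then have ij': "i + 1 \<in> {1..<N}" "j + 1 \<in> {1..<N}"
      by auto
    have "((\<lambda>\<sigma>. (LINT x|lborel. bump (i + 1) \<sigma> x * bump (j + 1) \<sigma> x / dens \<sigma> x) / wim_scale d \<sigma>)
        \<longlongrightarrow> (if i = j then 1 / sqrt (gmm_weight \<theta> (i + 1) * gmm_weight \<theta> (i + 2)) else 0)) (at_right 0)"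
    proof (cases i j rule: linorder_cases)
      case less
      then show ?thesis
        using bump_bump_integral_tendsto_0[OF ij'] by simp
    next
      case equal
      then show ?thesis
        using bump_sq_integral_tendsto[OF ij'(1)] by simp
    next
      \<comment> \<open>The off-diagonal limit is stated with the smaller index first; commuting the
        product covers this order.\<close>
      case greater
      then show ?thesis
        using bump_bump_integral_tendsto_0[OF ij'(2,1)] by (simp add: mult.commute)
    qed
    moreover have "\<forall>\<^sub>F \<sigma> in at_right 0. (LINT x|lborel. bump (i + 1) \<sigma> x * bump (j + 1) \<sigma> x / dens \<sigma> x) / wim_scale d \<sigma>
        = ((1 / wim_scale d \<sigma>) \<cdot>\<^sub>m G\<theta>\<theta> \<sigma>) $$ (i, j)"
      using pos
    proof eventually_elim
      case (elim \<sigma>)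
      then show ?case
        using block_dims(1)[OF elim] ij entries(1)[OF elim elim elim elim elim ij] TT[OF elim ij'] by simp
    qed
    ultimately have "((\<lambda>\<sigma>. ((1 / wim_scale d \<sigma>) \<cdot>\<^sub>m G\<theta>\<theta> \<sigma>) $$ (i, j)) \<longlongrightarrow>
        (if i = j then 1 / sqrt (gmm_weight \<theta> (i + 1) * gmm_weight \<theta> (i + 2)) else 0)) (at_right 0)"
      by (rule Lim_transform_eventually)
    then show "((\<lambda>\<sigma>. ((1 / wim_scale d \<sigma>) \<cdot>\<^sub>m G\<theta>\<theta> \<sigma>) $$ (i, j)) \<longlongrightarrow>
        mat_diag (N - 1) (\<lambda>i. 1 / sqrt (gmm_weight \<theta> (i + 1) * gmm_weight \<theta> (i + 2))) $$ (i, j)) (at_right 0)"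
      using ij by (auto simp: mat_diag_def)
  qed
  moreover have "mat_tendsto G\<mu>\<mu> (mat_diag N (\<lambda>i. gmm_weight \<theta> (i + 1))) (at_right 0)"
    unfolding mat_tendsto_def
  proof (intro conjI allI impI)
    show "\<forall>\<^sub>F \<sigma> in at_right 0. G\<mu>\<mu> \<sigma> \<in> carrier_mat
        (dim_row (mat_diag N (\<lambda>i. gmm_weight \<theta> (i + 1)))) (dim_col (mat_diag N (\<lambda>i. gmm_weight \<theta> (i + 1))))"
      using pos by eventually_elim (use block_dims(4) in \<open>simp add: mat_diag_def\<close>)
    fix i j
    assume "i < dim_row (mat_diag N (\<lambda>i. gmm_weight \<theta> (i + 1)))" "j < dim_col (mat_diag N (\<lambda>i. gmm_weight \<theta> (i + 1)))"
    then have ij: "i < N" "j < N"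
      by (simp_all add: mat_diag_def)
    then have ij': "i + 1 \<in> {1..N}" "j + 1 \<in> {1..N}"
      by auto
    have "\<forall>\<^sub>F \<sigma> in at_right 0. (LINT x|lborel. gmm_weight \<theta> (i + 1) * normal_density (\<mu> (i + 1)) \<sigma> x * resp (j + 1) \<sigma> x)
        = G\<mu>\<mu> \<sigma> $$ (i, j)"
      using pos
    proof eventually_elim
      case (elim \<sigma>)
      show ?case
        unfolding entries(4)[OF elim elim elim elim elim ij] MM[OF elim ij'] ..
    qed
    from Lim_transform_eventually[OF component_resp_integral_tendsto[OF ij'] this]
    show "((\<lambda>\<sigma>. G\<mu>\<mu> \<sigma> $$ (i, j)) \<longlongrightarrow> mat_diag N (\<lambda>i. gmm_weight \<theta> (i + 1)) $$ (i, j)) (at_right 0)"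
      using ij by (auto simp: mat_diag_def)
  qed
  moreover have "mat_tendsto G\<theta>\<mu>
        (Matrix.mat (N - 1) N
          (\<lambda>(i, j). if j = i \<or> j = i + 1 then (\<mu> (i + 2) - \<mu> (i + 1)) / 2 else 0)) (at_right 0)"
    unfolding mat_tendsto_def dim_row_mat dim_col_mat
  proof (intro conjI allI impI)
    show "\<forall>\<^sub>F \<sigma> in at_right 0. G\<theta>\<mu> \<sigma> \<in> carrier_mat (N - 1) N"
      using pos by eventually_elim (rule block_dims(2))
    fix i j assume ij: "i < N - 1" "j < N"
    then have ij': "i + 1 \<in> {1..<N}" "j + 1 \<in> {1..N}"
      by auto
    have "\<forall>\<^sub>F \<sigma> in at_right 0. (LINT x|lborel. bump (i + 1) \<sigma> x * resp (j + 1) \<sigma> x) = G\<theta>\<mu> \<sigma> $$ (i, j)"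
      using pos
    proof eventually_elim
      case (elim \<sigma>)
      show ?case
        unfolding entries(2)[OF elim elim elim elim elim ij] TM[OF elim ij'] ..
    qed
    from Lim_transform_eventually[OF bump_resp_integral_tendsto[OF ij'] this]
    show "((\<lambda>\<sigma>. G\<theta>\<mu> \<sigma> $$ (i, j)) \<longlongrightarrow> Matrix.mat (N - 1) N
        (\<lambda>(i, j). if j = i \<or> j = i + 1 then (\<mu> (i + 2) - \<mu> (i + 1)) / 2 else 0) $$ (i, j)) (at_right 0)"
      \<comment> \<open>The common spacing identifies the prescribed entry with
        \<open>d / 2\<close>; shifting both indices by one preserves the condition on them.\<close>
      using ij spacing[OF ij'(1)] by auto
  qed
  ultimately show ?thesis
    using integrable transpose by blast
qed

end
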